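(* Let $\mathbf{T}_{CM}$ be a CM-estimate of the regression slopes based on a function $\rho$ satisfying A3 (with constants $b\in(0,1)$ and $c>0$), and assume that $H_o$ is the multivariate normal distribution $N(\mathbf{0},\mathbf{I}_{p+1})$. Then, for $0<\varepsilon<\min\{b,1-b\}$, the maximum bias function of $\mathbf{T}_{CM}$ is $$B_{CM}(\varepsilon)=\{\exp[2c\varepsilon+2D_c(\varepsilon)]-1\}^{1/2}.$$
   Context: Model. $(y,\mathbf{x})\in\mathbb{R}\times\mathbb{R}^p$ has joint distribution $H_o=N(\mathbf{0},\mathbf{I}_{p+1})$. Condition A3 (for a function $\rho:\mathbb{R}\to[0,\infty)$): (i) $\rho$ is symmetric, nondecreasing on $[0,\infty)$, $\rho(0)=0$; (ii) $\rho$ is bounded with $\lim_{u\to\infty}\rho(u)=1$; (iii) $\rho$ has only finitely many discontinuities. Maximum bias. For $0<\varepsilon<1$, $V_\varepsilon=\{(1-\varepsilon)H_o+\varepsilon H^*: H^* \text{ any probability distribution on }\mathbb{R}^{p+1}\}$. For an $\mathbb{R}^p$-valued functional $\mathbf{T}$ (with $\mathbf{T}(H_o)=\mathbf{0}$, weakly continuous at $H_o$), the asymptotic bias at $H$ is $b(\mathbf{T},H)=\|\mathbf{T}(H)\|$ (Euclidean norm) if $\mathbf{T}(H)$ is defined and finite, and $b(\mathbf{T},H)=\infty$ otherwise; the maximum bias function is $B_{\mathbf{T}}(\varepsilon)=\sup\{b(\mathbf{T},H):H\in V_\varepsilon\}$. CM-estimates. Given $\rho$, $b\in(0,1)$ and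 $c>0$, the CM-estimates of intercept, slopes and scale $\{t_{CM}(H),\mathbf{T}_{CM}(H),\sigma_{CM}(H)\}$ are the solution $(\alpha,\boldsymbol{\theta},\sigma)$, $\sigma>0$, minimizing $c\,E_H[\rho((y-\alpha-\mathbf{x}'\boldsymbol{\theta})/\sigma)]+\log\sigma$ subject to the constraint $E_H[\rho((y-\alpha-\mathbf{x}'\boldsymbol{\theta})/\sigma)]\le b$. Notation. With $Z$ standard normal, $g(s)=E\rho(Z/s)$ for $s>0$; $\sigma_{b,\varepsilon}=g^{-1}[(b-\varepsilon)/(1-\varepsilon)]$; $\gamma_{b,\varepsilon}=g^{-1}[b/(1-\varepsilon)]$; $A_{c,\varepsilon}(s)=c(1-\varepsilon)g(s)+\log s$; and $$D_c(\varepsilon)=\inf_{s\ge\sigma_{b,\varepsilon}}A_{c,\varepsilon}(s)-\inf_{s\ge\gamma_{b,\varepsilon}}A_{c,\varepsilon}(s).$$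
   Formalization: It is also assumed that for each H in V_ε at which the constraint can be met, the minimum defining the CM-estimate is attained (it can fail for discontinuous ρ, making the bias infinite); where g^{-1} has no value it is set to ∞, so the formula reads ∞. *)

theory Defs
  imports "HOL-Probability.Probability"
begin

text \<open>
  An observation \<open>(y, x)\<close>, response and \<open>p\<close> covariates, is an element of
  \<^typ>\<open>real \<times> (real ^ 'p)\<close>; distributions of observations are Borel measures on this type.
\<close>

definition prob_dist :: "'a::topological_space measure \<Rightarrow> bool" where
  "prob_dist H \<longleftrightarrow> prob_space H \<and> sets H = sets borel"

text \<open>The standard normal distribution \<open>N(0, I)\<close> of \<open>(y, x)\<close>: independent standard normal coordinates.\<close>

definition H_std :: "(real \<times> (real ^ 'p)) measure" where
  "H_std = density lborel
     (\<lambda>(y, x). ennreal (std_normal_density y * (\<Prod>i\<in>UNIV. std_normal_density (x $ i))))"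

definition mixture :: "real \<Rightarrow> 'a::topological_space measure \<Rightarrow> 'a measure \<Rightarrow> 'a measure" where
  "mixture \<epsilon> M N = measure_of UNIV (sets borel)
     (\<lambda>A. ennreal (1 - \<epsilon>) * emeasure M A + ennreal \<epsilon> * emeasure N A)"

lemma sets_mixture: "sets (mixture \<epsilon> M N) = sets borel"
  unfolding mixture_def by (simp add: sets.sigma_sets_eq[of borel, simplified] sets_measure_of)

lemma emeasure_mixture:
  assumes "sets M = sets borel" "sets N = sets borel" "A \<in> sets borel"
  shows "emeasure (mixture \<epsilon> M N) A = ennreal (1 - \<epsilon>) * emeasure M A + ennreal \<epsilon> * emeasure N A"
proof (rule emeasure_measure_of[OF mixture_def])
  show "sets borel \<subseteq> Pow (UNIV :: 'a set)" by simp
  show "A \<in> sets (mixture \<epsilon> M N)" using assms by (simp add: sets_mixture)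
  show "positive (sets (mixture \<epsilon> M N))
      (\<lambda>A. ennreal (1 - \<epsilon>) * emeasure M A + ennreal \<epsilon> * emeasure N A)"
    by (simp add: positive_def)
  show "countably_additive (sets (mixture \<epsilon> M N))
      (\<lambda>A. ennreal (1 - \<epsilon>) * emeasure M A + ennreal \<epsilon> * emeasure N A)"
  proof (rule countably_additiveI)
    fix B :: "nat \<Rightarrow> 'a set"
    assume B: "range B \<subseteq> sets (mixture \<epsilon> M N)" "disjoint_family B"
    have M: "(\<Sum>i. emeasure M (B i)) = emeasure M (\<Union>i. B i)"
      and N: "(\<Sum>i. emeasure N (B i)) = emeasure N (\<Union>i. B i)"
      using B assms by (auto intro!: suminf_emeasure simp: sets_mixture)
    show "(\<Sum>i. ennreal (1 - \<epsilon>) * emeasure M (B i) + ennreal \<epsilon> * emeasure N (B i))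
        = ennreal (1 - \<epsilon>) * emeasure M (\<Union>i. B i) + ennreal \<epsilon> * emeasure N (\<Union>i. B i)"
      by (subst suminf_add[symmetric]) (simp_all add: M N)
  qed
qed

definition contamination_nbhd :: "real \<Rightarrow> (real \<times> (real ^ 'p)) measure set" where
  "contamination_nbhd \<epsilon> = {mixture \<epsilon> H_std H' | H'. prob_dist H'}"

definition A3 :: "(real \<Rightarrow> real) \<Rightarrow> bool" where
  "A3 \<rho> \<longleftrightarrow>
     (\<forall>u. 0 \<le> \<rho> u) \<and>
     (\<forall>u. \<rho> (- u) = \<rho> u) \<and> mono_on {0..} \<rho> \<and> \<rho> 0 = 0 \<and>
     bounded (range \<rho>) \<and> (\<rho> \<longlongrightarrow> 1) at_top \<and>
     finite {u. \<not> isCont \<rho> u}"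

text \<open>
  A slope functional returns \<^const>\<open>None\<close> where it is not defined; its bias there is infinite.
\<close>

type_synonym 'p slope_functional = "(real \<times> (real ^ 'p)) measure \<Rightarrow> (real ^ 'p) option"

definition asymptotic_bias ::
    "'p::finite slope_functional \<Rightarrow> (real \<times> (real ^ 'p)) measure \<Rightarrow> ereal" where
  "asymptotic_bias T H = (case T H of None \<Rightarrow> \<infinity> | Some \<theta> \<Rightarrow> ereal (norm \<theta>))"

definition max_bias :: "'p::finite slope_functional \<Rightarrow> real \<Rightarrow> ereal" where
  "max_bias T \<epsilon> = (SUP H\<in>contamination_nbhd \<epsilon>. asymptotic_bias T H)"

definition mean_rho ::
    "(real \<Rightarrow> real) \<Rightarrow> (real \<times> (real ^ 'p)) measure \<Rightarrow> real \<Rightarrow> real ^ 'p::finite \<Rightarrow> real \<Rightarrow> real" where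
  "mean_rho \<rho> H \<alpha> \<theta> \<sigma> = (\<integral>(y, x). \<rho> ((y - \<alpha> - x \<bullet> \<theta>) / \<sigma>) \<partial>H)"

definition CM_objective ::
    "(real \<Rightarrow> real) \<Rightarrow> real \<Rightarrow> (real \<times> (real ^ 'p)) measure \<Rightarrow> real \<Rightarrow> real ^ 'p::finite \<Rightarrow> real \<Rightarrow> real" where
  "CM_objective \<rho> c H \<alpha> \<theta> \<sigma> = c * mean_rho \<rho> H \<alpha> \<theta> \<sigma> + ln \<sigma>"

definition CM_feasible ::
    "(real \<Rightarrow> real) \<Rightarrow> real \<Rightarrow> (real \<times> (real ^ 'p)) measure \<Rightarrow> real \<Rightarrow> real ^ 'p::finite \<Rightarrow> real \<Rightarrow> bool" where
  "CM_feasible \<rho> b H \<alpha> \<theta> \<sigma> \<longleftrightarrow> \<sigma> > 0 \<and> mean_rho \<rho> H \<alpha> \<theta> \<sigma> \<le> b"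

definition CM_solution ::
    "(real \<Rightarrow> real) \<Rightarrow> real \<Rightarrow> real \<Rightarrow> (real \<times> (real ^ 'p)) measure \<Rightarrow> real \<times> (real ^ 'p::finite) \<times> real \<Rightarrow> bool" where
  "CM_solution \<rho> b c H = (\<lambda>(\<alpha>, \<theta>, \<sigma>).
     CM_feasible \<rho> b H \<alpha> \<theta> \<sigma> \<and>
     (\<forall>\<alpha>' \<theta>' \<sigma>'. CM_feasible \<rho> b H \<alpha>' \<theta>' \<sigma>' \<longrightarrow>
        CM_objective \<rho> c H \<alpha> \<theta> \<sigma> \<le> CM_objective \<rho> c H \<alpha>' \<theta>' \<sigma>'))"

text \<open>
  A CM-estimate of intercept, slopes and scale selects a solution of the minimization problem
  whenever there is one (solutions need not be unique), and is undefined otherwise.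
\<close>

type_synonym 'p CM_functional =
  "(real \<times> (real ^ 'p)) measure \<Rightarrow> (real \<times> (real ^ 'p) \<times> real) option"

definition CM_estimate ::
    "(real \<Rightarrow> real) \<Rightarrow> real \<Rightarrow> real \<Rightarrow> 'p::finite CM_functional \<Rightarrow> bool" where
  "CM_estimate \<rho> b c F \<longleftrightarrow> (\<forall>H. prob_dist H \<longrightarrow>
     (case F H of None \<Rightarrow> \<not> (\<exists>s. CM_solution \<rho> b c H s) | Some s \<Rightarrow> CM_solution \<rho> b c H s))"

definition CM_slopes :: "'p::finite CM_functional \<Rightarrow> 'p slope_functional" where
  "CM_slopes F H = map_option (\<lambda>(\<alpha>, \<theta>, \<sigma>). \<theta>) (F H)"

definition g_fun :: "(real \<Rightarrow> real) \<Rightarrow> real \<Rightarrow> real" where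
  "g_fun \<rho> s = (\<integral>z. \<rho> (z / s) \<partial>std_normal_distribution)"

text \<open>
  Under A3, \<open>\<rho>\<close> may jump at the origin. Then \<open>g\<close> does not decrease to \<open>0\<close> but to
  \<open>d = lim\<^bsub>u \<rightarrow> 0+\<^esub> \<rho> u\<close>, and the values in \<open>(0, d]\<close> are not attained. For these
  \<open>g\<^sup>-\<^sup>1\<close> is set to \<open>\<infinity>\<close>; an infimum over \<open>s \<ge> \<infinity>\<close> is then an infimum over the empty set,
  that is, \<open>\<infinity>\<close>.
\<close>

definition g_inv :: "(real \<Rightarrow> real) \<Rightarrow> real \<Rightarrow> ereal" where
  "g_inv \<rho> t = (if \<exists>s>0. g_fun \<rho> s = t then ereal (THE s. s > 0 \<and> g_fun \<rho> s = t) else \<infinity>)"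

definition sigma_be :: "(real \<Rightarrow> real) \<Rightarrow> real \<Rightarrow> real \<Rightarrow> ereal" where
  "sigma_be \<rho> b \<epsilon> = g_inv \<rho> ((b - \<epsilon>) / (1 - \<epsilon>))"

definition gamma_be :: "(real \<Rightarrow> real) \<Rightarrow> real \<Rightarrow> real \<Rightarrow> ereal" where
  "gamma_be \<rho> b \<epsilon> = g_inv \<rho> (b / (1 - \<epsilon>))"

definition A_ce :: "(real \<Rightarrow> real) \<Rightarrow> real \<Rightarrow> real \<Rightarrow> real \<Rightarrow> real" where
  "A_ce \<rho> c \<epsilon> s = c * (1 - \<epsilon>) * g_fun \<rho> s + ln s"

text \<open>
  The difference is of the form \<open>\<infinity> - \<infinity>\<close>, which is \<open>\<infinity>\<close> on \<^typ>\<open>ereal\<close>, only if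
  \<open>b / (1 - \<epsilon>) \<le> d\<close>. The CM constraint is then not satisfiable at the normal distribution itself,
  where the estimate has infinite bias.
\<close>

definition D_c :: "(real \<Rightarrow> real) \<Rightarrow> real \<Rightarrow> real \<Rightarrow> real \<Rightarrow> ereal" where
  "D_c \<rho> b c \<epsilon> =
     (INF s\<in>{s. s > 0 \<and> ereal s \<ge> sigma_be \<rho> b \<epsilon>}. ereal (A_ce \<rho> c \<epsilon> s)) -
     (INF s\<in>{s. s > 0 \<and> ereal s \<ge> gamma_be \<rho> b \<epsilon>}. ereal (A_ce \<rho> c \<epsilon> s))"

fun exp_ereal :: "ereal \<Rightarrow> ereal" where
  "exp_ereal (ereal r) = ereal (exp r)"
| "exp_ereal PInfty = \<infinity>"
| "exp_ereal MInfty = 0"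

text \<open>As for \<^const>\<open>sqrt\<close> on the reals, the extension is odd.\<close>

fun sqrt_ereal :: "ereal \<Rightarrow> ereal" where
  "sqrt_ereal (ereal r) = ereal (sqrt r)"
| "sqrt_ereal PInfty = \<infinity>"
| "sqrt_ereal MInfty = - \<infinity>"

end

theory Submission
  imports Defs
begin

text \<open>
  Under the normal model the residual of a fit \<open>(\<alpha>, \<theta>)\<close> is normal with standard deviation
  \<open>r = sqrt (1 + \<parallel>\<theta>\<parallel>\<^sup>2)\<close>, and since \<open>\<rho>\<close> is even and unimodal the intercept only increases the mean
  of \<open>\<rho>\<close>, which is thus at least \<open>g (\<sigma> / r)\<close>. In terms of \<open>s = \<sigma> / r\<close> the objective at a contaminated
  distribution is at least \<open>A s + ln r\<close>, with \<open>(1 - \<epsilon>) * g s \<le> b\<close> by the constraint; the fit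
  \<open>(0, 0, s')\<close>, feasible whenever \<open>(1 - \<epsilon>) * g s' + \<epsilon> \<le> b\<close>, costs at most \<open>A s' + c * \<epsilon>\<close>.
  Comparing these costs bounds \<open>ln r\<close>, hence the bias, from above.

  For the lower bound, contaminate by a point mass at \<open>n\<close> times a fixed point of the hyperplane
  \<open>y = t * (x \<bullet> e)\<close>. The fit with slope \<open>t e\<close> does not feel the contamination. If all solutions
  had slopes of norm at most \<open>t' < t\<close>, their scales and intercepts would be bounded, so the
  contaminating point would eventually contribute the full \<open>\<epsilon>\<close>. A limit point of the
  corresponding \<open>s\<close> then has \<open>(1 - \<epsilon>) * g s + \<epsilon> \<le> b\<close> and \<open>A s + c * \<epsilon>\<close> at most the cost of the fit
  with slope \<open>t e\<close>, which fails when \<open>t\<close> is below the claimed bias.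
\<close>

section \<open>The standard normal distribution of an observation\<close>

text \<open>Product measures are determined by rectangles. On a rectangle the density times the
  indicator factors over the coordinates, so the integral is a product of one-dimensional integrals.
  Points of the product space are extensional, which makes the indicator factor.\<close>

lemma density_PiM:
  assumes "finite I" "\<And>i. sigma_finite_measure (M i)"
    and "\<And>i. sigma_finite_measure (density (M i) (f i))"
    and [measurable]: "\<And>i. f i \<in> borel_measurable (M i)"
  shows "density (Pi\<^sub>M I M) (\<lambda>x. \<Prod>i\<in>I. f i (x i)) = Pi\<^sub>M I (\<lambda>i. density (M i) (f i))"
proof -
  interpret M: product_sigma_finite M by (simp add: product_sigma_finite_def assms)
  interpret D: product_sigma_finite "\<lambda>i. density (M i) (f i)"
    by (simp add: product_sigma_finite_def assms)
  show ?thesis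
  proof (rule D.PiM_eqI)
    show "finite I" by fact
    show "sets (density (Pi\<^sub>M I M) (\<lambda>x. \<Prod>i\<in>I. f i (x i)))
        = sets (Pi\<^sub>M I (\<lambda>i. density (M i) (f i)))"
      by (simp cong: sets_PiM_cong)
  next
    fix A assume "\<And>i. i \<in> I \<Longrightarrow> A i \<in> sets (density (M i) (f i))"
    then have A[measurable]: "\<And>i. i \<in> I \<Longrightarrow> A i \<in> sets (M i)" by simp
    have PA: "Pi\<^sub>E I A \<in> sets (Pi\<^sub>M I M)" using assms(1) A by (intro sets_PiM_I_finite) auto
    have "emeasure (density (Pi\<^sub>M I M) (\<lambda>x. \<Prod>i\<in>I. f i (x i))) (Pi\<^sub>E I A)
        = (\<integral>\<^sup>+x. (\<Prod>i\<in>I. f i (x i)) * indicator (Pi\<^sub>E I A) x \<partial>Pi\<^sub>M I M)"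
      using PA by (intro emeasure_density) auto
    also have "\<dots> = (\<integral>\<^sup>+x. (\<Prod>i\<in>I. f i (x i) * indicator (A i) (x i)) \<partial>Pi\<^sub>M I M)"
    proof (intro nn_integral_cong)
      fix x assume "x \<in> space (Pi\<^sub>M I M)"
      then have "x \<in> extensional I" by (auto simp: space_PiM PiE_def)
      then have "indicator (Pi\<^sub>E I A) x = (\<Prod>i\<in>I. indicator (A i) (x i) :: ennreal)"
        using assms(1)
        by (auto simp: indicator_def PiE_def Pi_iff prod_zero_iff intro: prod.neutral)
      then show "(\<Prod>i\<in>I. f i (x i)) * indicator (Pi\<^sub>E I A) x
          = (\<Prod>i\<in>I. f i (x i) * indicator (A i) (x i))"
        by (simp add: prod.distrib)
    qed
    also have "\<dots> = (\<Prod>i\<in>I. \<integral>\<^sup>+x. f i x * indicator (A i) x \<partial>M i)"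
      using assms(1) by (intro M.product_nn_integral_prod) auto
    also have "\<dots> = (\<Prod>i\<in>I. emeasure (density (M i) (f i)) (A i))"
      by (intro prod.cong refl) (simp add: emeasure_density)
    finally show "emeasure (density (Pi\<^sub>M I M) (\<lambda>x. \<Prod>i\<in>I. f i (x i))) (Pi\<^sub>E I A)
        = (\<Prod>i\<in>I. emeasure (density (M i) (f i)) (A i))" .
  qed
qed

text \<open>Lebesgue measure on a Euclidean space is the image of a product over the basis, and the
  density is a product over the same basis. In this form the independence of the coordinates becomes
  available.\<close>

lemma H_std_eq_distr:
  "(H_std :: (real \<times> (real ^ 'p::finite)) measure) =
     distr (\<Pi>\<^sub>M b\<in>Basis. std_normal_distribution) borel (\<lambda>f. \<Sum>b\<in>Basis. f b *\<^sub>R b)"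
proof -
  let ?B = "Basis :: (real \<times> (real ^ 'p)) set"
  let ?S = "\<lambda>f. \<Sum>b\<in>?B. f b *\<^sub>R b"
  interpret std: prob_space std_normal_distribution by (rule prob_space_normal_density) simp
  have prod: "std_normal_density y * (\<Prod>i\<in>UNIV. std_normal_density (x $ i)) =
      (\<Prod>b\<in>?B. std_normal_density ((y, x) \<bullet> b))" for y x
  proof -
    have "(\<Prod>b\<in>?B. std_normal_density ((y, x) \<bullet> b)) =
        std_normal_density y * (\<Prod>b\<in>Basis. std_normal_density (x \<bullet> b))"
      unfolding Basis_prod_def
      by (subst prod.union_disjoint) (auto simp: prod.reindex inj_on_def)
    also have "(\<Prod>b\<in>Basis. std_normal_density (x \<bullet> b)) = (\<Prod>i\<in>UNIV. std_normal_density (x $ i))"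
      by (simp add: Basis_vec_def UNION_singleton_eq_range prod.reindex inj_on_def axis_eq_axis
          inner_axis)
    finally show ?thesis by simp
  qed
  have "(H_std :: (real \<times> (real ^ 'p)) measure) =
      density lborel (\<lambda>z. \<Prod>b\<in>?B. ennreal (std_normal_density (z \<bullet> b)))"
    unfolding H_std_def by (intro arg_cong2[where f=density] refl ext) (auto simp: prod prod_ennreal)
  also have "\<dots> = distr (density (\<Pi>\<^sub>M b\<in>?B. lborel)
      (\<lambda>f. \<Prod>b\<in>?B. ennreal (std_normal_density (?S f \<bullet> b)))) borel ?S"
    unfolding lborel_eq[where 'a="real \<times> (real ^ 'p)"] by (rule density_distr) auto
  also have "density (\<Pi>\<^sub>M b\<in>?B. lborel) (\<lambda>f. \<Prod>b\<in>?B. ennreal (std_normal_density (?S f \<bullet> b))) =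
      density (\<Pi>\<^sub>M b\<in>?B. lborel) (\<lambda>f. \<Prod>b\<in>?B. ennreal (std_normal_density (f b)))"
    by (intro arg_cong2[where f=density] refl ext prod.cong) simp
  also have "\<dots> = (\<Pi>\<^sub>M b\<in>?B. std_normal_distribution)"
    by (rule density_PiM)
      (auto intro: sigma_finite_lborel std.sigma_finite_measure_axioms)
  finally show ?thesis .
qed

lemma prob_space_H_std: "prob_space (H_std :: (real \<times> (real ^ 'p::finite)) measure)"
  unfolding H_std_eq_distr
  by (intro prob_space.prob_space_distr prob_space_PiM prob_space_normal_density) auto

lemma sets_H_std [simp]: "sets (H_std :: (real \<times> (real ^ 'p::finite)) measure) = sets borel"
  by (simp add: H_std_def)

text \<open>The inner product with \<open>v\<close> is a sum of independent centred normal variables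
  whose variances \<open>(v \<bullet> b)\<^sup>2\<close> add up to
  \<open>(norm v)\<^sup>2\<close>.\<close>

lemma distr_H_std_inner:
  fixes v :: "real \<times> (real ^ 'p::finite)"
  assumes "v \<noteq> 0"
  shows "distr H_std borel (\<lambda>z. (z \<bullet> v) / norm v) = std_normal_distribution"
proof -
  let ?B = "Basis :: (real \<times> (real ^ 'p)) set"
  let ?S = "\<lambda>f. \<Sum>b\<in>?B. f b *\<^sub>R b"
  define P where "P = (\<Pi>\<^sub>M b\<in>?B. std_normal_distribution)"
  have std: "prob_space std_normal_distribution" by (rule prob_space_normal_density) simp
  interpret P: prob_space P unfolding P_def by (intro prob_space_PiM std)
  \<comment> \<open>The sum rule for independent normals asks for positive standard deviations and a
    nonempty index set; basis vectors with zero coefficient are dropped, and some remain because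
    \<open>v \<noteq> 0\<close>.\<close>
  define J where "J = {b\<in>?B. v \<bullet> b \<noteq> 0}"
  have J: "finite J" "J \<subseteq> ?B" by (auto simp: J_def)
  have Jne: "J \<noteq> {}" using assms euclidean_all_zero_iff[of v] unfolding J_def by blast
  have meas[measurable]: "b \<in> ?B \<Longrightarrow> (\<lambda>f. f b) \<in> P \<rightarrow>\<^sub>M borel" for b
    unfolding P_def using measurable_component_singleton[of b ?B "\<lambda>_. std_normal_distribution"]
    by simp
  have comp: "b \<in> ?B \<Longrightarrow> distr P borel (\<lambda>f. f b) = std_normal_distribution" for b
    using distr_PiM_component[of ?B "\<lambda>_. std_normal_distribution" b] std
    by (simp add: P_def cong: distr_cong)
  \<comment> \<open>Independence amounts to the joint law being the product of the marginals; here
    both are \<open>P\<close>, since restricting an extensional function to the basis changes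
    nothing.\<close>
  have "P.indep_vars (\<lambda>_. borel) (\<lambda>b f. f b) ?B"
  proof (subst P.indep_vars_iff_distr_eq_PiM')
    have "(\<Pi>\<^sub>M b\<in>?B. distr P borel (\<lambda>f. f b)) = P"
      unfolding P_def by (intro PiM_cong refl) (simp add: comp[unfolded P_def])
    moreover have "distr P (\<Pi>\<^sub>M b\<in>?B. borel) (\<lambda>x. \<lambda>i\<in>?B. x i) = distr P P (\<lambda>x. x)"
    proof (rule distr_cong)
      show "sets (\<Pi>\<^sub>M b\<in>?B. borel) = sets P" by (auto simp: P_def intro!: sets_PiM_cong)
      show "\<And>x. x \<in> space P \<Longrightarrow> (\<lambda>i\<in>?B. x i) = x"
        by (auto simp: P_def space_PiM)
    qed simp
    ultimately show "distr P (\<Pi>\<^sub>M b\<in>?B. borel) (\<lambda>x. \<lambda>i\<in>?B. x i)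
        = (\<Pi>\<^sub>M b\<in>?B. distr P borel (\<lambda>f. f b))" by (simp add: distr_id)
  qed auto
  then have "P.indep_vars (\<lambda>_. borel) (\<lambda>b f. f b) J"
    using J(2) by (rule P.indep_vars_subset)
  then have ind: "P.indep_vars (\<lambda>_. borel) (\<lambda>b f. (v \<bullet> b) * f b) J"
    by (rule P.indep_vars_compose2) auto
  have dist: "distributed P lborel (\<lambda>f. (v \<bullet> b) * f b) (normal_density 0 \<bar>v \<bullet> b\<bar>)" if "b \<in> J" for b
  proof -
    have "b \<in> ?B" using that J by auto
    then have "distributed P lborel (\<lambda>f. f b) std_normal_density"
      using comp[of b] by (auto simp: distributed_def cong: distr_cong)
    from P.normal_density_affine[OF this, of "v \<bullet> b" 0] that show ?thesis
      by (simp add: J_def)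
  qed
  have sq: "(\<Sum>b\<in>J. \<bar>v \<bullet> b\<bar>\<^sup>2) = (norm v)\<^sup>2"
  proof -
    have "(\<Sum>b\<in>J. \<bar>v \<bullet> b\<bar>\<^sup>2) = (\<Sum>b\<in>?B. (v \<bullet> b)\<^sup>2)"
      by (subst power2_abs) (intro sum.mono_neutral_left, auto simp: J_def)
    also have "\<dots> = (norm v)\<^sup>2"
      by (subst power2_norm_eq_inner, subst euclidean_inner) (simp add: power2_eq_square)
    finally show ?thesis .
  qed
  have sum: "(\<Sum>b\<in>J. (v \<bullet> b) * f b) = ?S f \<bullet> v" for f
  proof -
    have "(\<Sum>b\<in>J. (v \<bullet> b) * f b) = (\<Sum>b\<in>?B. (v \<bullet> b) * f b)"
      by (intro sum.mono_neutral_left) (auto simp: J_def)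
    also have "\<dots> = ?S f \<bullet> v"
      by (simp add: inner_sum_left inner_commute[of v] mult.commute del: inner_sum_left_Basis)
    finally show ?thesis .
  qed
  have "\<And>b. b \<in> J \<Longrightarrow> 0 < \<bar>v \<bullet> b\<bar>" by (simp add: J_def)
  from P.sum_indep_normal[OF J(1) Jne ind this dist]
  have "distributed P lborel (\<lambda>f. ?S f \<bullet> v) (normal_density 0 (norm v))"
    unfolding sum sq by simp
  then have "distributed P lborel (\<lambda>f. (?S f \<bullet> v) / norm v) std_normal_density"
    using P.normal_standard_normal_convert[of "norm v" "\<lambda>f. ?S f \<bullet> v" 0] assms by simp
  then have "distr P lborel (\<lambda>f. (?S f \<bullet> v) / norm v) = std_normal_distribution"
    by (simp add: distributed_def)
  moreover have "?S \<in> P \<rightarrow>\<^sub>M borel" by measurable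
  ultimately show ?thesis
    unfolding H_std_eq_distr P_def[symmetric]
    by (subst distr_distr) (auto simp: comp_def cong: distr_cong)
qed

section \<open>Means of \<open>\<rho>\<close> under the standard normal distribution\<close>

lemma prob_space_std_normal: "prob_space std_normal_distribution"
  by (rule prob_space_normal_density) simp

lemma AE_std_normal_iff: "(AE z in std_normal_distribution. P z) \<longleftrightarrow> (AE z in lborel. P z)"
proof -
  have "(AE z in std_normal_distribution. P z)
      \<longleftrightarrow> (AE z in lborel. 0 < ennreal (std_normal_density z) \<longrightarrow> P z)"
    by (rule AE_density) simp
  then show ?thesis by (simp add: normal_density_pos)
qed

lemma AE_lborel_finite:
  assumes "finite (S :: real set)"
  shows "AE z in lborel. z \<notin> S"
  by (rule AE_not_in) (use assms finite_imp_null_set_lborel in blast)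

text \<open>The one-dimensional Anderson inequality. The hypothesis \<open>mono\<close> encodes
  evenness together with monotonicity on the half line. It is what allows the intercept to be
  removed from lower bounds.\<close>

lemma std_normal_shift_le:
  fixes f :: "real \<Rightarrow> real"
  assumes mono: "\<And>u v. \<bar>u\<bar> \<le> \<bar>v\<bar> \<Longrightarrow> f u \<le> f v"
    and [measurable]: "f \<in> borel_measurable borel"
    and bdd: "\<And>u. \<bar>f u\<bar> \<le> C"
  shows "(\<integral>z. f z \<partial>std_normal_distribution) \<le> (\<integral>z. f (z - \<mu>) \<partial>std_normal_distribution)"
proof -
  interpret std: prob_space std_normal_distribution by (rule prob_space_std_normal)
  let ?\<phi> = std_normal_density
  have even: "f (- u) = f u" for u by (intro antisym mono) auto
  have intN: "integrable std_normal_distribution (\<lambda>z. f (z - m))" for m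
    by (rule std.integrable_const_bound[where B=C]) (auto simp: bdd)
  have int: "integrable lborel (\<lambda>z. ?\<phi> z * f (z - m))" for m
    using intN[of m] by (subst (asm) integrable_real_density) auto
  have eq: "(\<integral>z. f (z - m) \<partial>std_normal_distribution) = (\<integral>z. ?\<phi> z * f (z - m) \<partial>lborel)" for m
    by (subst integral_real_density) auto
  define a where "a z = f (z - \<mu>) - f z" for z
  have a_meas[measurable]: "a \<in> borel_measurable borel" by (simp add: a_def[abs_def])
  have inta: "integrable lborel (\<lambda>z. ?\<phi> z * a z)"
    using Bochner_Integration.integrable_diff[OF int[of \<mu>] int[of 0]]
    by (simp add: a_def right_diff_distrib)
  define I where "I = (\<integral>z. ?\<phi> z * a z \<partial>lborel)"
  have I: "I = (\<integral>z. f (z - \<mu>) \<partial>std_normal_distribution) - (\<integral>z. f z \<partial>std_normal_distribution)"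
    using Bochner_Integration.integral_diff[OF int[of \<mu>] int[of 0]] eq[of \<mu>] eq[of 0]
    by (simp add: I_def a_def right_diff_distrib)
  have a_refl: "a (\<mu> - z) = - a z" for z
    using even[of z] even[of "z - \<mu>"] by (simp add: a_def)
  have phi_refl: "?\<phi> (\<mu> - z) = ?\<phi> (z - \<mu>)" for z
    by (simp add: normal_density_def power2_commute)
  have refl: "?\<phi> (\<mu> + - 1 * z) * a (\<mu> + - 1 * z) = - (?\<phi> (z - \<mu>) * a z)" for z
    by (simp add: a_refl phi_refl)
  have "I = \<bar>- 1\<bar> *\<^sub>R (\<integral>z. ?\<phi> (\<mu> + - 1 * z) * a (\<mu> + - 1 * z) \<partial>lborel)"
    unfolding I_def by (rule lborel_integral_real_affine) simp
  then have I2: "I = (\<integral>z. - (?\<phi> (z - \<mu>) * a z) \<partial>lborel)"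
    unfolding refl by simp
  have int2: "integrable lborel (\<lambda>z. - (?\<phi> (z - \<mu>) * a z))"
    using lborel_integrable_real_affine[OF inta, of "-1" \<mu>] by (simp only: refl)
  \<comment> \<open>The reflection \<open>z \<mapsto> \<mu> - z\<close> exchanges \<open>z\<close> and \<open>z - \<mu>\<close> up to sign, and of these two points
    the one farther from \<open>0\<close> has the larger value of \<open>f\<close> and the smaller density.\<close>
  have "2 * I = (\<integral>z. ?\<phi> z * a z + - (?\<phi> (z - \<mu>) * a z) \<partial>lborel)"
    using Bochner_Integration.integral_add[OF inta int2] I_def I2 by simp
  also have "\<dots> \<ge> 0"
  proof (rule Bochner_Integration.integral_nonneg)
    fix z
    have "0 \<le> (?\<phi> z - ?\<phi> (z - \<mu>)) * a z"
    proof (cases "\<bar>z\<bar> \<le> \<bar>z - \<mu>\<bar>")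
      case True
      then have "z\<^sup>2 \<le> (z - \<mu>)\<^sup>2" by (simp add: abs_le_square_iff)
      then have "?\<phi> (z - \<mu>) \<le> ?\<phi> z" by (simp add: normal_density_def divide_right_mono)
      then show ?thesis using mono[OF True] by (simp add: a_def)
    next
      case False
      then have "(z - \<mu>)\<^sup>2 \<le> z\<^sup>2" by (simp add: abs_le_square_iff)
      then have "?\<phi> z \<le> ?\<phi> (z - \<mu>)" by (simp add: normal_density_def divide_right_mono)
      then show ?thesis using mono[of "z - \<mu>" z] False
        by (intro mult_nonpos_nonpos) (simp_all add: a_def)
    qed
    then show "0 \<le> ?\<phi> z * a z + - (?\<phi> (z - \<mu>) * a z)" by (simp add: left_diff_distrib)
  qed
  finally show ?thesis using I by simp
qed

section \<open>Elementary properties of \<open>\<rho>\<close>\<close>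

locale A3_rho =
  fixes \<rho> :: "real \<Rightarrow> real"
  assumes A3: "A3 \<rho>"
begin

abbreviation N :: "real measure" where "N \<equiv> std_normal_distribution"

abbreviation g :: "real \<Rightarrow> real" where "g \<equiv> g_fun \<rho>"

sublocale N: prob_space N by (rule prob_space_std_normal)

lemma prob_N_UNIV [simp]: "N.prob UNIV = 1"
  using N.prob_space by simp

lemma rho_nonneg: "0 \<le> \<rho> u"
  and rho_minus: "\<rho> (- u) = \<rho> u"
  and rho_zero [simp]: "\<rho> 0 = 0"
  and rho_tendsto: "(\<rho> \<longlongrightarrow> 1) at_top"
  and finite_discont: "finite {u. \<not> isCont \<rho> u}"
  using A3 by (auto simp: A3_def)

lemma rho_abs: "\<rho> \<bar>u\<bar> = \<rho> u"
  by (cases "0 \<le> u") (auto simp: rho_minus)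

lemma rho_mono:
  assumes "\<bar>u\<bar> \<le> \<bar>v\<bar>" shows "\<rho> u \<le> \<rho> v"
proof -
  have "\<rho> \<bar>u\<bar> \<le> \<rho> \<bar>v\<bar>"
    using A3 assms unfolding A3_def by (auto dest!: mono_onD[where r="\<bar>u\<bar>" and s="\<bar>v\<bar>"])
  then show ?thesis by (simp add: rho_abs)
qed

lemma rho_le_1: "\<rho> u \<le> 1"
proof (rule tendsto_lowerbound[OF rho_tendsto])
  show "eventually (\<lambda>v. \<rho> u \<le> \<rho> v) at_top"
    using eventually_ge_at_top[of "\<bar>u\<bar>"] by eventually_elim (rule rho_mono, simp)
qed simp

text \<open>Composing with \<open>max 0\<close> extends the half of \<open>\<rho>\<close> on the
  nonnegative axis to a monotone, hence Borel, function on the line; evenness then recovers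
  \<open>\<rho>\<close> through the absolute value.\<close>

lemma rho_measurable [measurable]: "\<rho> \<in> borel_measurable borel"
proof -
  have "mono (\<lambda>u. \<rho> (max 0 u))" by (intro monoI rho_mono) auto
  then have [measurable]: "(\<lambda>u. \<rho> (max 0 u)) \<in> borel_measurable borel"
    by (rule borel_measurable_mono)
  have "(\<lambda>u. \<rho> (max 0 \<bar>u\<bar>)) \<in> borel_measurable borel" by measurable
  then show ?thesis by (simp add: rho_abs)
qed

lemma integrable_rho:
  assumes "prob_space M" and [measurable]: "f \<in> borel_measurable M"
  shows "integrable M (\<lambda>x. \<rho> (f x))"
proof -
  interpret prob_space M by fact
  show ?thesis
    by (rule integrable_const_bound[where B=1]) (auto simp: rho_nonneg rho_le_1)
qed

lemma integral_rho_le_1: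
  assumes "prob_space M" "f \<in> borel_measurable M"
  shows "(\<integral>x. \<rho> (f x) \<partial>M) \<le> 1"
proof -
  interpret prob_space M by fact
  show ?thesis by (rule integral_le_const[OF integrable_rho[OF assms]]) (simp add: rho_le_1)
qed

lemma integrable_N [simp]: "f \<in> borel_measurable borel \<Longrightarrow> integrable N (\<lambda>x. \<rho> (f x))"
  by (rule integrable_rho[OF prob_space_std_normal]) simp

lemma integral_rho_tendsto:
  assumes [measurable]: "\<And>n :: nat. f n \<in> borel_measurable borel" "h \<in> borel_measurable borel"
    and lim: "AE z in N. (\<lambda>n. \<rho> (f n z)) \<longlonglongrightarrow> h z"
  shows "(\<lambda>n. \<integral>z. \<rho> (f n z) \<partial>N) \<longlonglongrightarrow> (\<integral>z. h z \<partial>N)"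
  by (rule integral_dominated_convergence[where w="\<lambda>_. 1"])
    (use lim in \<open>auto simp: rho_nonneg rho_le_1\<close>)

lemma rho_at_top:
  assumes "filterlim f at_top F" shows "((\<lambda>n. \<rho> (f n)) \<longlongrightarrow> 1) F"
  using filterlim_compose[OF rho_tendsto assms] .

lemma AE_N_nonzero: "AE z in N. z \<noteq> 0"
  unfolding AE_std_normal_iff using AE_lborel_finite[of "{0}"] by simp

section \<open>Monotonicity, continuity and inversion of \<open>g\<close>\<close>

lemma g_antimono:
  assumes "0 < s" "s \<le> s'" shows "g s' \<le> g s"
  unfolding g_fun_def
  by (intro integral_mono integrable_N rho_mono)
    (use assms in \<open>auto simp: divide_left_mono\<close>)

text \<open>The point \<open>z / s\<close> is a discontinuity of \<open>\<rho>\<close> for finitely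
  many \<open>z\<close> only, a null set under the normal law, so dominated convergence
  applies.\<close>

lemma g_cont:
  assumes "0 < s" shows "isCont g s"
  unfolding continuous_at_sequentially
proof (intro allI impI)
  fix x :: "nat \<Rightarrow> real" assume x: "x \<longlonglongrightarrow> s"
  have "finite ((\<lambda>u. s * u) ` {u. \<not> isCont \<rho> u})" using finite_discont by simp
  then have "AE z in N. z \<notin> (\<lambda>u. s * u) ` {u. \<not> isCont \<rho> u}"
    unfolding AE_std_normal_iff by (rule AE_lborel_finite)
  then have "AE z in N. (\<lambda>n. \<rho> (z / x n)) \<longlonglongrightarrow> \<rho> (z / s)"
  proof (rule AE_mp, intro AE_I2 impI)
    fix z assume z: "z \<notin> (\<lambda>u. s * u) ` {u. \<not> isCont \<rho> u}"
    have "isCont \<rho> (z / s)"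
    proof (rule ccontr)
      assume "\<not> isCont \<rho> (z / s)"
      then have "s * (z / s) \<in> (\<lambda>u. s * u) ` {u. \<not> isCont \<rho> u}" by blast
      then show False using z assms by simp
    qed
    moreover have "(\<lambda>n. z / x n) \<longlonglongrightarrow> z / s" using x assms by (intro tendsto_intros) auto
    ultimately show "(\<lambda>n. \<rho> (z / x n)) \<longlonglongrightarrow> \<rho> (z / s)" by (rule isCont_tendsto_compose)
  qed
  then show "(g \<circ> x) \<longlonglongrightarrow> g s"
    unfolding comp_def g_fun_def by (intro integral_rho_tendsto) auto
qed

text \<open>For \<open>z \<noteq> 0\<close> the ratio \<open>z / s\<close> grows without bound in
  absolute value as \<open>s\<close> tends to 0, so \<open>g\<close> tends to the limit 1 of
  \<open>\<rho>\<close> at infinity.\<close>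

lemma g_near_0:
  assumes "t < 1" obtains s where "0 < s" "t < g s"
proof -
  have "(\<lambda>n. \<integral>z. \<rho> (z / (1 / real (Suc n))) \<partial>N) \<longlonglongrightarrow> (\<integral>z. 1 \<partial>N)"
  proof (rule integral_rho_tendsto)
    show "AE z in N. (\<lambda>n. \<rho> (z / (1 / real (Suc n)))) \<longlonglongrightarrow> 1"
      using AE_N_nonzero
    proof (rule AE_mp, intro AE_I2 impI)
      fix z :: real assume z: "z \<noteq> 0"
      have "filterlim (\<lambda>n. \<bar>z\<bar> * real (Suc n)) at_top sequentially"
        using z by (intro filterlim_tendsto_pos_mult_at_top[OF tendsto_const]
            filterlim_compose[OF filterlim_real_sequentially filterlim_Suc]) auto
      from rho_at_top[OF this] show "(\<lambda>n. \<rho> (z / (1 / real (Suc n)))) \<longlonglongrightarrow> 1"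
        by (subst (asm) rho_abs[symmetric], subst rho_abs[symmetric]) (simp add: abs_mult)
    qed
  qed auto
  then have "(\<lambda>n. g (1 / real (Suc n))) \<longlonglongrightarrow> 1" by (simp add: g_fun_def del: of_nat_Suc)
  from order_tendstoD(1)[OF this assms] obtain n where "t < g (1 / real (Suc n))"
    by (auto simp: eventually_sequentially)
  then show ?thesis by (intro that[of "1 / real (Suc n)"]) auto
qed

text \<open>So \<open>g\<close> is strictly decreasing wherever it is below 1. Either
  \<open>\<rho>\<close> is invariant under scaling by some \<open>q > 1\<close>, and then iterating
  the scaling out to infinity gives \<open>\<rho> = 1\<close> off the origin; or
  \<open>\<rho>\<close> increases strictly from some \<open>v\<close> to \<open>q * v\<close>, and
  the two integrands differ on an interval of positive length, contradicting equality.\<close>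

lemma g_inj:
  assumes "0 < s" "s < s'" "g s = g s'"
  shows "g s = 1"
proof -
  \<comment> \<open>With the full ratio \<open>s' / s\<close> the interval below would shrink to a
    point. The square root gives \<open>s * q < s'\<close>, and for \<open>z\<close> between
    \<open>s * q * v\<close> and \<open>s' * v\<close> one has \<open>z / s \<ge> q * v\<close> and
    \<open>z / s' \<le> v\<close>.\<close>
  define q where "q = sqrt (s' / s)"
  have q: "1 < q" using assms by (simp add: q_def)
  have qq: "s * q * q = s'" using assms by (simp add: q_def mult.assoc)
  show ?thesis
  proof (cases "\<forall>v>0. \<rho> (q * v) = \<rho> v")
    case True
    have pow: "\<rho> (q ^ k * v) = \<rho> v" if "0 < v" for k v
    proof (induction k)
      case (Suc k)
      have "0 < q ^ k * v" using q that by simp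
      with True Suc show ?case by (simp add: mult.assoc)
    qed simp
    have one: "\<rho> v = 1" if "0 < v" for v
    proof -
      have "filterlim (\<lambda>k. v * q ^ k) at_top sequentially"
        using that q
        by (intro filterlim_tendsto_pos_mult_at_top[OF tendsto_const]
            filterlim_at_infinity_imp_filterlim_at_top filterlim_realpow_sequentially_gt1) auto
      from rho_at_top[OF this] have "(\<lambda>k. \<rho> v) \<longlonglongrightarrow> 1" using pow[OF that] by (simp add: mult.commute)
      then show ?thesis using LIMSEQ_unique tendsto_const by blast
    qed
    have "g s = (\<integral>z. 1 \<partial>N)"
      unfolding g_fun_def
    proof (rule integral_cong_AE)
      show "AE z in N. \<rho> (z / s) = 1"
        using AE_N_nonzero
      proof (rule AE_mp, intro AE_I2 impI)
        fix z :: real assume "z \<noteq> 0"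
        then have "\<rho> \<bar>z / s\<bar> = 1" using assms by (intro one) auto
        then show "\<rho> (z / s) = 1" by (simp only: rho_abs)
      qed
    qed auto
    then show ?thesis by simp
  next
    case False
    then obtain v where v: "0 < v" "\<rho> (q * v) \<noteq> \<rho> v" by auto
    have lt: "\<rho> v < \<rho> (q * v)" using v q rho_mono[of v "q * v"] by (auto simp: abs_mult)
    let ?h = "\<lambda>z. \<rho> (z / s) - \<rho> (z / s')"
    have h0: "0 \<le> ?h z" for z
      using rho_mono[of "z / s'" "z / s"] assms by (simp add: divide_left_mono)
    have "(\<integral>z. ?h z \<partial>N) = 0" using assms(3) by (simp add: g_fun_def)
    then have "AE z in N. ?h z = 0"
      by (subst (asm) integral_nonneg_eq_0_iff_AE) (use h0 in auto)
    then have "AE z in lborel. z \<notin> {s * q * v .. s' * v}"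
      unfolding AE_std_normal_iff
    proof (rule AE_mp, intro AE_I2 impI notI)
      fix z assume z: "?h z = 0" "z \<in> {s * q * v .. s' * v}"
      have pos: "0 < s * q * v" "0 < s'" using assms q v by auto
      then have "0 < z" using z by auto
      have "\<rho> (q * v) \<le> \<rho> (z / s)"
        by (rule rho_mono) (use z assms q v \<open>0 < z\<close> in \<open>auto simp: field_simps\<close>)
      moreover have "\<rho> (z / s') \<le> \<rho> v"
        by (rule rho_mono) (use z assms q v \<open>0 < z\<close> in \<open>auto simp: field_simps\<close>)
      ultimately show False using z lt by simp
    qed
    then have "emeasure lborel {s * q * v .. s' * v} = 0"
      by (subst (asm) AE_iff_null_sets[symmetric]) (auto simp: null_sets_def)
    moreover have lt: "s * q * v < s' * v" using assms q v qq[symmetric] by simp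
    then have "emeasure lborel {s * q * v .. s' * v} = ennreal (s' * v - s * q * v)"
      by (intro emeasure_lborel_Icc) simp
    ultimately have "s' * v - s * q * v \<le> 0" by (simp only: ennreal_eq_0_iff)
    with lt show ?thesis by linarith
  qed
qed

text \<open>This justifies the value \<open>\<infinity>\<close> of the inverse: an attained
  \<open>t < 1\<close> is attained once, by \<open>g_inj\<close>; if \<open>t\<close> is not
  attained, \<open>g\<close> stays above it, since \<open>g\<close> exceeds \<open>t\<close> near 0
  and the intermediate value theorem forbids crossing.\<close>

lemma g_inv_le_iff:
  assumes "t < 1" "0 < s"
  shows "g_inv \<rho> t \<le> ereal s \<longleftrightarrow> g s \<le> t"
proof (cases "\<exists>s0>0. g s0 = t")
  case True
  then obtain s0 where s0: "0 < s0" "g s0 = t" by auto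
  have uniq: "s' = s0" if "0 < s' \<and> g s' = t" for s'
    using g_inj[of s' s0] g_inj[of s0 s'] that s0 assms(1)
    by (cases s' s0 rule: linorder_cases) auto
  have "(THE s. 0 < s \<and> g s = t) = s0" 
    using s0 uniq by (intro the_equality) (blast intro: conjI)+
  then have inv: "g_inv \<rho> t = ereal s0" using True by (auto simp: g_inv_def)
  have "s0 \<le> s \<longleftrightarrow> g s \<le> t"
  proof
    assume "s0 \<le> s"
    with g_antimono[of s0 s] s0 show "g s \<le> t" by simp
  next
    assume "g s \<le> t"
    show "s0 \<le> s"
    proof (rule ccontr)
      assume "\<not> s0 \<le> s"
      with g_antimono[of s s0] s0 assms \<open>g s \<le> t\<close> have "0 < s \<and> g s = t" by simp
      with uniq \<open>\<not> s0 \<le> s\<close> show False by blast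
    qed
  qed
  then show ?thesis by (simp add: inv)
next
  case False
  then have inv: "g_inv \<rho> t = \<infinity>" by (auto simp: g_inv_def)
  have "\<not> g s \<le> t"
  proof
    assume "g s \<le> t"
    obtain s1 where s1: "0 < s1" "t < g s1" using g_near_0[OF assms(1)] .
    have "s1 \<le> s" using g_antimono[of s s1] s1 \<open>g s \<le> t\<close> assms by (cases "s1 \<le> s") auto
    then have "\<exists>x. s1 \<le> x \<and> x \<le> s \<and> g x = t"
      using s1 \<open>g s \<le> t\<close> by (intro IVT2) (auto intro: g_cont)
    then obtain x where "s1 \<le> x" "g x = t" by blast
    moreover from this s1 have "0 < x" by simp
    ultimately show False using False by blast
  qed
  then show ?thesis by (simp add: inv)
qed

section \<open>Residual means with an intercept\<close>

lemma integral_rho_affine_ge: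
  assumes "0 < \<sigma>" "0 < r"
  shows "g (\<sigma> / r) \<le> (\<integral>z. \<rho> ((r * z - \<alpha>) / \<sigma>) \<partial>N)"
proof -
  have "(\<integral>z. \<rho> (r / \<sigma> * z) \<partial>N) \<le> (\<integral>z. \<rho> (r / \<sigma> * (z - \<alpha> / r)) \<partial>N)"
    using assms
    by (intro std_normal_shift_le[where f="\<lambda>z. \<rho> (r / \<sigma> * z)" and C=1] rho_mono)
      (auto simp: abs_mult mult_left_mono divide_right_mono rho_nonneg rho_le_1)
  moreover have "r / \<sigma> * (z - \<alpha> / r) = (r * z - \<alpha>) / \<sigma>" for z
    using assms by (simp add: field_simps)
  moreover have "r / \<sigma> * z = z / (\<sigma> / r)" for z by simp
  ultimately show ?thesis unfolding g_fun_def by (simp only:)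
qed

text \<open>Used to bound the intercepts of feasible fits. For
  \<open>\<bar>\<alpha>\<bar> \<ge> n\<close> one function of \<open>z\<close> bounds all scaled
  residuals from below, uniformly in the slope and scale ranges, and its mean of
  \<open>\<rho>\<close> tends to 1. The \<open>max 0\<close> keeps that bound nonnegative, as
  \<open>\<rho>\<close> is monotone in the absolute value.\<close>

lemma integral_rho_far:
  assumes "t < 1" "0 < S"
  obtains M where "\<And>\<alpha> r \<sigma>. 0 < \<sigma> \<Longrightarrow> \<sigma> \<le> S \<Longrightarrow> \<bar>r\<bar> \<le> R \<Longrightarrow> M \<le> \<bar>\<alpha>\<bar> \<Longrightarrow>
    t < (\<integral>z. \<rho> ((r * z - \<alpha>) / \<sigma>) \<partial>N)"
proof -
  have "(\<lambda>n. \<integral>z. \<rho> (max 0 ((real n - R * \<bar>z\<bar>) / S)) \<partial>N) \<longlonglongrightarrow> (\<integral>z. 1 \<partial>N)"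
  proof (rule integral_rho_tendsto)
    show "AE z in N. (\<lambda>n. \<rho> (max 0 ((real n - R * \<bar>z\<bar>) / S))) \<longlonglongrightarrow> 1"
    proof (intro AE_I2 rho_at_top)
      fix z :: real
      have "filterlim (\<lambda>n. - (R * \<bar>z\<bar>) / S + 1 / S * real n) at_top sequentially"
        using assms by (intro filterlim_tendsto_add_at_top[OF tendsto_const]
            filterlim_tendsto_pos_mult_at_top[OF tendsto_const] filterlim_real_sequentially) auto
      then show "filterlim (\<lambda>n. max 0 ((real n - R * \<bar>z\<bar>) / S)) at_top sequentially"
        by (rule filterlim_at_top_mono) (simp add: diff_divide_distrib max_def)
    qed
  qed auto
  then have "(\<lambda>n. \<integral>z. \<rho> (max 0 ((real n - R * \<bar>z\<bar>) / S)) \<partial>N) \<longlonglongrightarrow> 1"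
    by simp
  from order_tendstoD(1)[OF this assms(1)]
  obtain n where n: "t < (\<integral>z. \<rho> (max 0 ((real n - R * \<bar>z\<bar>) / S)) \<partial>N)"
    by (auto simp: eventually_sequentially)
  have "t < (\<integral>z. \<rho> ((r * z - \<alpha>) / \<sigma>) \<partial>N)"
    if h: "0 < \<sigma>" "\<sigma> \<le> S" "\<bar>r\<bar> \<le> R" "real n \<le> \<bar>\<alpha>\<bar>" for \<alpha> r \<sigma>
  proof -
    have "(\<integral>z. \<rho> (max 0 ((real n - R * \<bar>z\<bar>) / S)) \<partial>N) \<le> (\<integral>z. \<rho> ((r * z - \<alpha>) / \<sigma>) \<partial>N)"
    proof (intro integral_mono integrable_N rho_mono)
      fix z :: real
      have "real n - R * \<bar>z\<bar> \<le> \<bar>r * z - \<alpha>\<bar>"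
        using h mult_right_mono[OF h(3), of "\<bar>z\<bar>"] by (simp add: abs_mult[symmetric])
      then have "(real n - R * \<bar>z\<bar>) / S \<le> \<bar>r * z - \<alpha>\<bar> / S" using h by (intro divide_right_mono) auto
      also have "\<dots> \<le> \<bar>r * z - \<alpha>\<bar> / \<sigma>" using h by (intro divide_left_mono) auto
      finally show "\<bar>max 0 ((real n - R * \<bar>z\<bar>) / S)\<bar> \<le> \<bar>(r * z - \<alpha>) / \<sigma>\<bar>"
        using h by (simp add: abs_divide)
    qed auto
    with n show ?thesis by simp
  qed
  then show ?thesis by (rule that)
qed

end

section \<open>Contaminated distributions\<close>

text \<open>Induction over measurable functions. In the limit step both integrals increase along the
  sequence, so the suprema may be added.\<close>

lemma nn_integral_mixture:
  assumes sets: "sets M = sets borel" "sets N = sets borel" and "f \<in> borel_measurable borel"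
  shows "(\<integral>\<^sup>+x. f x \<partial>mixture \<epsilon> M N) =
    ennreal (1 - \<epsilon>) * (\<integral>\<^sup>+x. f x \<partial>M) + ennreal \<epsilon> * (\<integral>\<^sup>+x. f x \<partial>N)"
proof -
  note [measurable_cong] = sets sets_mixture
  note [simp] = sets sets_mixture sets_eq_imp_space_eq[OF sets(1)] sets_eq_imp_space_eq[OF sets(2)]
    sets_eq_imp_space_eq[OF sets_mixture]
  show ?thesis
    using assms(3)
  proof (induction rule: borel_measurable_induct)
    case (cong f h)
    then have "f = h" by auto
    with cong show ?case by simp
  next
    case (set A)
    then show ?case by (simp add: emeasure_mixture)
  next
    case (mult u k)
    then show ?case by (simp add: nn_integral_cmult distrib_left mult.left_commute)
  next
    case (add u v)
    then show ?case by (simp add: nn_integral_add distrib_left add_ac)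
  next
    case (seq U)
    have SUP: "(\<integral>\<^sup>+x. (SUP i. U i) x \<partial>K) = (SUP i. \<integral>\<^sup>+x. U i x \<partial>K)"
      if [measurable_cong]: "sets K = sets borel" for K :: "'a measure"
      unfolding SUP_apply using seq by (intro nn_integral_monotone_convergence_SUP) auto
    have inc: "incseq (\<lambda>i. k * (\<integral>\<^sup>+x. U i x \<partial>K))" for K :: "'a measure" and k
      using seq
      by (intro incseq_SucI mult_left_mono nn_integral_mono) (auto simp: incseq_def le_fun_def)
    show ?case
      using seq.IH inc
      by (simp add: SUP[unfolded SUP_apply] SUP_mult_left_ennreal ennreal_SUP_add image_comp)
  qed
qed

lemma prob_dist_mixture:
  assumes "prob_dist M" "prob_dist N" "0 \<le> \<epsilon>" "\<epsilon> \<le> 1"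
  shows "prob_dist (mixture \<epsilon> M N)"
proof -
  have M: "emeasure M UNIV = 1" "sets M = sets borel"
    and N: "emeasure N UNIV = 1" "sets N = sets borel"
    using assms prob_space.emeasure_space_1[of M] prob_space.emeasure_space_1[of N]
      sets_eq_imp_space_eq[of M borel] sets_eq_imp_space_eq[of N borel]
    by (auto simp: prob_dist_def)
  have "emeasure (mixture \<epsilon> M N) UNIV = 1"
    using M N assms by (simp add: emeasure_mixture ennreal_plus[symmetric] del: ennreal_plus)
  then show ?thesis
    unfolding prob_dist_def
    by (auto intro!: prob_spaceI simp: sets_mixture sets_eq_imp_space_eq[OF sets_mixture])
qed

lemma prob_dist_H_std: "prob_dist (H_std :: (real \<times> (real ^ 'p::finite)) measure)"
  by (simp add: prob_dist_def prob_space_H_std)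

lemma prob_dist_return: "prob_dist (return borel z)"
  by (simp add: prob_dist_def prob_space_return)

lemma integral_mixture:
  fixes f :: "'a::topological_space \<Rightarrow> real"
  assumes "sets M = sets borel" "sets N = sets borel" and [measurable]: "f \<in> borel_measurable borel"
    and f: "\<And>x. 0 \<le> f x" "integrable M f" "integrable N f" and "0 \<le> \<epsilon>" "\<epsilon> \<le> 1"
  shows "(\<integral>x. f x \<partial>mixture \<epsilon> M N) = (1 - \<epsilon>) * (\<integral>x. f x \<partial>M) + \<epsilon> * (\<integral>x. f x \<partial>N)"
proof -
  have nn: "0 \<le> (\<integral>x. f x \<partial>M)" "0 \<le> (\<integral>x. f x \<partial>N)" using f by simp_all
  have "(\<integral>\<^sup>+x. ennreal (f x) \<partial>mixture \<epsilon> M N) =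
      ennreal (1 - \<epsilon>) * ennreal (\<integral>x. f x \<partial>M) + ennreal \<epsilon> * ennreal (\<integral>x. f x \<partial>N)"
    using assms by (simp add: nn_integral_mixture nn_integral_eq_integral)
  also have "\<dots> = ennreal ((1 - \<epsilon>) * (\<integral>x. f x \<partial>M) + \<epsilon> * (\<integral>x. f x \<partial>N))"
    using nn assms by (simp add: ennreal_mult)
  finally have eq: "(\<integral>\<^sup>+x. ennreal (f x) \<partial>mixture \<epsilon> M N) =
      ennreal ((1 - \<epsilon>) * (\<integral>x. f x \<partial>M) + \<epsilon> * (\<integral>x. f x \<partial>N))" .
  have meas: "f \<in> borel_measurable (mixture \<epsilon> M N)"
    by (subst measurable_cong_sets[OF sets_mixture refl]) fact
  have pos: "0 \<le> (1 - \<epsilon>) * (\<integral>x. f x \<partial>M) + \<epsilon> * (\<integral>x. f x \<partial>N)"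
    using nn assms(7,8) by (intro add_nonneg_nonneg mult_nonneg_nonneg) auto
  have "(\<integral>x. f x \<partial>mixture \<epsilon> M N) = enn2real (\<integral>\<^sup>+x. ennreal (f x) \<partial>mixture \<epsilon> M N)"
    by (intro integral_eq_nn_integral meas AE_I2 f(1))
  also have "\<dots> = (1 - \<epsilon>) * (\<integral>x. f x \<partial>M) + \<epsilon> * (\<integral>x. f x \<partial>N)"
    unfolding eq by (rule enn2real_ennreal[OF pos])
  finally show ?thesis .
qed

lemma exp_sqrt_ereal_infinity: "exp_ereal \<infinity> = \<infinity>" "sqrt_ereal \<infinity> = \<infinity>"
  by (simp_all only: infinity_ereal_def exp_ereal.simps sqrt_ereal.simps)

text \<open>The type is general so that the same function applies to a slope vector and to a real
  number standing for its length.\<close>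

definition resid_sd :: "'a::real_normed_vector \<Rightarrow> real" where
  "resid_sd \<theta> = sqrt (1 + (norm \<theta>)\<^sup>2)"

lemma resid_sd_ge_1: "1 \<le> resid_sd \<theta>"
  by (simp add: resid_sd_def)

lemma resid_sd_le_iff: "resid_sd x \<le> resid_sd y \<longleftrightarrow> norm x \<le> norm y"
  by (simp add: resid_sd_def flip: abs_le_square_iff)

section \<open>Means of \<open>\<rho>\<close> under the normal law and its mixtures\<close>

context A3_rho
begin

lemma residual_measurable [measurable]:
  "(\<lambda>(y, x). \<rho> ((y - \<alpha> - x \<bullet> \<theta>) / \<sigma>)) \<in>
    borel_measurable (borel :: (real \<times> (real ^ 'p::finite)) measure)"
proof -
  have "(\<lambda>z :: real \<times> (real ^ 'p). fst z - \<alpha> - snd z \<bullet> \<theta>) \<in> borel_measurable borel"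
    by (intro borel_measurable_continuous_onI continuous_intros)
  then have "(\<lambda>z :: real \<times> (real ^ 'p). \<rho> ((fst z - \<alpha> - snd z \<bullet> \<theta>) / \<sigma>)) \<in> borel_measurable borel"
    by measurable
  then show ?thesis by (simp add: case_prod_beta)
qed

text \<open>Apart from the intercept, the residual is the inner product of the observation with
  \<open>(1, - \<theta>)\<close>, whose norm is \<open>resid_sd \<theta>\<close>.\<close>

lemma mean_rho_H_std:
  fixes \<theta> :: "real ^ 'p::finite"
  shows "mean_rho \<rho> H_std \<alpha> \<theta> \<sigma> = (\<integral>z. \<rho> ((resid_sd \<theta> * z - \<alpha>) / \<sigma>) \<partial>N)"
proof -
  define v :: "real \<times> (real ^ 'p)" where "v = (1, - \<theta>)"
  have v: "v \<noteq> 0" "norm v = resid_sd \<theta>"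
    by (auto simp: v_def zero_prod_def norm_Pair resid_sd_def)
  have pos: "resid_sd \<theta> \<noteq> 0" using resid_sd_ge_1[of \<theta>] by simp
  have [measurable]: "(\<lambda>z. (z \<bullet> v) / norm v) \<in> borel_measurable borel"
    by (intro borel_measurable_continuous_onI continuous_intros) (use v in auto)
  have "(\<integral>z. \<rho> ((resid_sd \<theta> * z - \<alpha>) / \<sigma>) \<partial>N) =
      (\<integral>z. \<rho> ((resid_sd \<theta> * ((z \<bullet> v) / norm v) - \<alpha>) / \<sigma>) \<partial>H_std)"
    unfolding distr_H_std_inner[OF v(1), symmetric]
    by (subst integral_distr) (auto simp: measurable_cong_sets[OF sets_H_std refl])
  also have "\<dots> = mean_rho \<rho> H_std \<alpha> \<theta> \<sigma>"
    unfolding mean_rho_def using pos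
    by (intro Bochner_Integration.integral_cong refl)
      (auto simp: v_def[symmetric] v(2), simp add: v_def algebra_simps)
  finally show ?thesis ..
qed

lemma mean_rho_mixture:
  fixes \<theta> :: "real ^ 'p::finite"
  assumes "prob_dist H" "0 \<le> \<epsilon>" "\<epsilon> \<le> 1"
  shows "mean_rho \<rho> (mixture \<epsilon> H_std H) \<alpha> \<theta> \<sigma> =
    (1 - \<epsilon>) * (\<integral>z. \<rho> ((resid_sd \<theta> * z - \<alpha>) / \<sigma>) \<partial>N) + \<epsilon> * mean_rho \<rho> H \<alpha> \<theta> \<sigma>"
proof -
  have H: "prob_space H" "sets H = sets borel" using assms by (auto simp: prob_dist_def)
  have [measurable]: "(\<lambda>z :: real \<times> (real ^ 'p). (fst z - \<alpha> - snd z \<bullet> \<theta>) / \<sigma>)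
      \<in> borel_measurable borel"
    by (intro borel_measurable_divide borel_measurable_continuous_onI continuous_intros)
  have int: "integrable K (\<lambda>(y, x). \<rho> ((y - \<alpha> - x \<bullet> \<theta>) / \<sigma>))"
    if "prob_space K" "sets K = sets borel" for K :: "(real \<times> (real ^ 'p)) measure"
    unfolding case_prod_beta
    using that by (intro integrable_rho) (auto simp: measurable_cong_sets[OF that(2) refl])
  show ?thesis
    unfolding mean_rho_H_std[symmetric] unfolding mean_rho_def
  proof (rule integral_mixture)
    show "integrable H_std (\<lambda>(y, x :: real ^ 'p). \<rho> ((y - \<alpha> - x \<bullet> \<theta>) / \<sigma>))"
      by (intro int prob_space_H_std sets_H_std)
    show "integrable H (\<lambda>(y, x). \<rho> ((y - \<alpha> - x \<bullet> \<theta>) / \<sigma>))"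
      by (intro int H)
    show "0 \<le> (case z of (y, x) \<Rightarrow> \<rho> ((y - \<alpha> - x \<bullet> \<theta>) / \<sigma>))" for z :: "real \<times> (real ^ 'p)"
      by (simp add: rho_nonneg split: prod.split)
  qed (use H assms residual_measurable in \<open>simp_all\<close>)
qed

lemma mean_rho_bounds:
  fixes \<theta> :: "real ^ 'p::finite"
  assumes "prob_dist H"
  shows "0 \<le> mean_rho \<rho> H \<alpha> \<theta> \<sigma>" "mean_rho \<rho> H \<alpha> \<theta> \<sigma> \<le> 1"
proof -
  have H: "prob_space H" "sets H = sets borel" using assms by (auto simp: prob_dist_def)
  have "(\<lambda>z :: real \<times> (real ^ 'p). (fst z - \<alpha> - snd z \<bullet> \<theta>) / \<sigma>)
      \<in> borel_measurable borel"
    by (intro borel_measurable_divide borel_measurable_continuous_onI continuous_intros)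
  then show "mean_rho \<rho> H \<alpha> \<theta> \<sigma> \<le> 1"
    unfolding mean_rho_def case_prod_beta using H
    by (intro integral_rho_le_1) (auto simp: measurable_cong_sets[OF H(2) refl])
  show "0 \<le> mean_rho \<rho> H \<alpha> \<theta> \<sigma>"
    unfolding mean_rho_def by (intro Bochner_Integration.integral_nonneg) (auto simp: rho_nonneg)
qed

lemma mean_rho_return:
  fixes \<theta> :: "real ^ 'p::finite"
  shows "mean_rho \<rho> (return borel (y, x)) \<alpha> \<theta> \<sigma> = \<rho> ((y - \<alpha> - x \<bullet> \<theta>) / \<sigma>)"
  unfolding mean_rho_def by (subst integral_return) auto

end

section \<open>Maximum bias\<close>

locale CM_setting = A3_rho +
  fixes b c \<epsilon> :: real
  assumes c: "0 < c" and eps: "0 < \<epsilon>" "\<epsilon> < b" "\<epsilon> < 1 - b"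
begin

section \<open>Admissible standardized scales\<close>

abbreviation A :: "real \<Rightarrow> real" where "A \<equiv> A_ce \<rho> c \<epsilon>"

text \<open>The half lines of the two infima in \<open>D_c\<close>, written without the inverse of
  \<open>g\<close>. Here contamination contributes its maximum \<open>\<epsilon>\<close> to the
  constraint, in \<open>S\<gamma>\<close> it contributes nothing. A set is empty exactly when its
  threshold is infinite.\<close>

definition S\<sigma> :: "real set" where "S\<sigma> = {s. 0 < s \<and> (1 - \<epsilon>) * g s + \<epsilon> \<le> b}"

definition S\<gamma> :: "real set" where "S\<gamma> = {s. 0 < s \<and> (1 - \<epsilon>) * g s \<le> b}"

lemma S_subset: "S\<sigma> \<subseteq> S\<gamma>"
  using eps by (auto simp: S\<sigma>_def S\<gamma>_def)

text \<open>Both arguments of the inverse are below 1, the second because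
  \<open>\<epsilon> < 1 - b\<close>, so \<open>g_inv_le_iff\<close> applies.\<close>

lemma D_c_eq: "D_c \<rho> b c \<epsilon> = (INF s\<in>S\<sigma>. ereal (A s)) - (INF s\<in>S\<gamma>. ereal (A s))"
proof -
  have "S\<sigma> = {s. 0 < s \<and> sigma_be \<rho> b \<epsilon> \<le> ereal s}"
    using eps g_inv_le_iff[of "(b - \<epsilon>) / (1 - \<epsilon>)"]
    by (auto simp: S\<sigma>_def sigma_be_def field_simps)
  moreover have "S\<gamma> = {s. 0 < s \<and> gamma_be \<rho> b \<epsilon> \<le> ereal s}"
    using eps g_inv_le_iff[of "b / (1 - \<epsilon>)"]
    by (auto simp: S\<gamma>_def gamma_be_def field_simps)
  ultimately show ?thesis by (simp add: D_c_def)
qed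

text \<open>The constraint prevents implosion of the scale: \<open>g\<close> exceeds
  \<open>b / (1 - \<epsilon>)\<close> near 0. This bounds \<open>A\<close> from below and later
  supplies compactness.\<close>

lemma S\<gamma>_lower_bound:
  obtains s1 where "0 < s1" "\<And>s. s \<in> S\<gamma> \<Longrightarrow> s1 \<le> s"
proof -
  have "b / (1 - \<epsilon>) < 1" using eps by (simp add: field_simps)
  then obtain s1 where s1: "0 < s1" "b / (1 - \<epsilon>) < g s1" by (rule g_near_0)
  have "s1 \<le> s" if "s \<in> S\<gamma>" for s
  proof (rule ccontr)
    assume "\<not> s1 \<le> s"
    then have "g s1 \<le> g s" using that by (intro g_antimono) (auto simp: S\<gamma>_def)
    moreover have "g s \<le> b / (1 - \<epsilon>)" using that eps by (simp add: S\<gamma>_def field_simps)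
    ultimately show False using s1 by simp
  qed
  with s1(1) show ?thesis by (rule that)
qed

lemma g_nonneg: "0 \<le> g s"
  unfolding g_fun_def by (intro Bochner_Integration.integral_nonneg) (simp add: rho_nonneg)

lemma A_bdd_below: "bdd_below (A ` S\<gamma>)"
proof -
  obtain s1 where s1: "0 < s1" "\<And>s. s \<in> S\<gamma> \<Longrightarrow> s1 \<le> s" by (rule S\<gamma>_lower_bound) blast
  have "ln s1 \<le> A s" if "s \<in> S\<gamma>" for s
  proof -
    have "ln s1 \<le> ln s" using s1(1) s1(2)[OF that] by simp
    moreover have "0 \<le> c * (1 - \<epsilon>) * g s" using c eps g_nonneg[of s] by simp
    ultimately show ?thesis by (simp add: A_ce_def)
  qed
  then show ?thesis by (auto simp: bdd_below_def)
qed

lemma A_cont: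
  assumes "0 < s" shows "isCont A s"
  unfolding A_ce_def[abs_def] by (intro continuous_intros g_cont) (use assms in auto)

section \<open>Costs of fits at contaminated distributions\<close>

lemma mean_rho_ge:
  fixes \<theta> :: "real ^ 'p::finite"
  assumes "prob_dist H" "0 < \<sigma>"
  shows "(1 - \<epsilon>) * g (\<sigma> / resid_sd \<theta>) + \<epsilon> * mean_rho \<rho> H \<alpha> \<theta> \<sigma>
    \<le> mean_rho \<rho> (mixture \<epsilon> H_std H) \<alpha> \<theta> \<sigma>"
  using integral_rho_affine_ge[of \<sigma> "resid_sd \<theta>" \<alpha>] resid_sd_ge_1[of \<theta>] assms eps
  by (simp add: mean_rho_mixture)

lemma mean_rho_centred:
  fixes \<theta> :: "real ^ 'p::finite"
  assumes "prob_dist H"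
  shows "mean_rho \<rho> (mixture \<epsilon> H_std H) 0 \<theta> (s * resid_sd \<theta>) =
    (1 - \<epsilon>) * g s + \<epsilon> * mean_rho \<rho> H 0 \<theta> (s * resid_sd \<theta>)"
proof -
  have "resid_sd \<theta> * z / (s * resid_sd \<theta>) = z / s" for z
    using resid_sd_ge_1[of \<theta>] by (simp add: field_simps)
  then show ?thesis using assms eps by (simp add: mean_rho_mixture g_fun_def)
qed

lemma feasible_scaled:
  fixes \<theta> :: "real ^ 'p::finite"
  assumes "prob_dist H" "CM_feasible \<rho> b (mixture \<epsilon> H_std H) \<alpha> \<theta> \<sigma>"
  shows "\<sigma> / resid_sd \<theta> \<in> S\<gamma>"
proof -
  have "0 < \<sigma>" "mean_rho \<rho> (mixture \<epsilon> H_std H) \<alpha> \<theta> \<sigma> \<le> b"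
    using assms by (auto simp: CM_feasible_def)
  moreover have "0 \<le> \<epsilon> * mean_rho \<rho> H \<alpha> \<theta> \<sigma>" using mean_rho_bounds[OF assms(1)] eps by simp
  ultimately show ?thesis
    using mean_rho_ge[OF assms(1) \<open>0 < \<sigma>\<close>, of \<theta> \<alpha>] resid_sd_ge_1[of \<theta>] by (simp add: S\<gamma>_def)
qed

text \<open>Standardizing the scale by \<open>resid_sd \<theta>\<close> splits off the logarithm of
  that factor from \<open>ln \<sigma>\<close>; this term is the price of a nonzero slope.\<close>

lemma objective_ge:
  fixes \<theta> :: "real ^ 'p::finite"
  assumes "prob_dist H" "0 < \<sigma>"
  shows "A (\<sigma> / resid_sd \<theta>) + ln (resid_sd \<theta>) + c * \<epsilon> * mean_rho \<rho> H \<alpha> \<theta> \<sigma>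
    \<le> CM_objective \<rho> c (mixture \<epsilon> H_std H) \<alpha> \<theta> \<sigma>"
proof -
  have "c * ((1 - \<epsilon>) * g (\<sigma> / resid_sd \<theta>) + \<epsilon> * mean_rho \<rho> H \<alpha> \<theta> \<sigma>)
      \<le> c * mean_rho \<rho> (mixture \<epsilon> H_std H) \<alpha> \<theta> \<sigma>"
    using mean_rho_ge[OF assms] c by (intro mult_left_mono) auto
  moreover have "ln (\<sigma> / resid_sd \<theta>) = ln \<sigma> - ln (resid_sd \<theta>)"
    using assms resid_sd_ge_1[of \<theta>] by (intro ln_divide_pos) auto
  ultimately show ?thesis by (simp add: CM_objective_def A_ce_def algebra_simps)
qed

lemma contaminated_feasible:
  assumes "prob_dist H" "s \<in> S\<sigma>"
  shows "CM_feasible \<rho> b (mixture \<epsilon> H_std H) 0 (0 :: real ^ 'p::finite) s"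
    and "CM_objective \<rho> c (mixture \<epsilon> H_std H) 0 (0 :: real ^ 'p) s \<le> A s + c * \<epsilon>"
proof -
  have s: "0 < s" "(1 - \<epsilon>) * g s + \<epsilon> \<le> b" using assms by (auto simp: S\<sigma>_def)
  have "\<epsilon> * mean_rho \<rho> H 0 (0 :: real ^ 'p) s \<le> \<epsilon>"
    using mean_rho_bounds(2)[OF assms(1), of 0 0 s] eps by simp
  then have le: "mean_rho \<rho> (mixture \<epsilon> H_std H) 0 (0 :: real ^ 'p) s \<le> (1 - \<epsilon>) * g s + \<epsilon>"
    using mean_rho_centred[OF assms(1), of 0 s] by (simp add: resid_sd_def)
  then show "CM_feasible \<rho> b (mixture \<epsilon> H_std H) 0 (0 :: real ^ 'p) s"
    using s by (simp add: CM_feasible_def)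
  show "CM_objective \<rho> c (mixture \<epsilon> H_std H) 0 (0 :: real ^ 'p) s \<le> A s + c * \<epsilon>"
    using mult_left_mono[OF le, of c] c by (simp add: CM_objective_def A_ce_def algebra_simps)
qed

lemma upper_bound:
  fixes \<theta> :: "real ^ 'p::finite"
  assumes "prob_dist H" "CM_solution \<rho> b c (mixture \<epsilon> H_std H) (\<alpha>, \<theta>, \<sigma>)" "s \<in> S\<sigma>"
  shows "A (\<sigma> / resid_sd \<theta>) + ln (resid_sd \<theta>) \<le> A s + c * \<epsilon>"
proof -
  have feas: "CM_feasible \<rho> b (mixture \<epsilon> H_std H) \<alpha> \<theta> \<sigma>"
    and opt: "CM_objective \<rho> c (mixture \<epsilon> H_std H) \<alpha> \<theta> \<sigma> \<le> CM_objective \<rho> c (mixture \<epsilon> H_std H) 0 0 s"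
    using assms(2) contaminated_feasible(1)[OF assms(1,3)] by (auto simp: CM_solution_def)
  have "0 \<le> c * \<epsilon> * mean_rho \<rho> H \<alpha> \<theta> \<sigma>" using mean_rho_bounds[OF assms(1)] c eps by simp
  then show ?thesis
    using opt objective_ge[OF assms(1), of \<sigma> \<theta> \<alpha>] feas contaminated_feasible(2)[OF assms(1,3)]
    by (simp add: CM_feasible_def)
qed

section \<open>Point-mass contamination and the lower bound\<close>

definition H_point :: "real \<Rightarrow> 'a::euclidean_space \<Rightarrow> nat \<Rightarrow> (real \<times> 'a) measure" where
  "H_point t e n = return borel (t * real n, real n *\<^sub>R e)"

text \<open>As \<open>e \<bullet> e = 1\<close>, the contaminating point has residual 0 at slope
  \<open>t *\<^sub>R e\<close>, and \<open>\<rho> 0 = 0\<close>; only the normal part enters the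
  mean.\<close>

lemma point_feasible:
  fixes e :: "real ^ 'p::finite"
  assumes e: "norm e = 1" and s: "s \<in> S\<gamma>"
  shows "CM_feasible \<rho> b (mixture \<epsilon> H_std (H_point t e n)) 0 (t *\<^sub>R e) (s * resid_sd t)"
    and "CM_objective \<rho> c (mixture \<epsilon> H_std (H_point t e n)) 0 (t *\<^sub>R e) (s * resid_sd t)
      = A s + ln (resid_sd t)"
proof -
  have s': "0 < s" "(1 - \<epsilon>) * g s \<le> b" using s by (auto simp: S\<gamma>_def)
  have sd: "resid_sd (t *\<^sub>R e) = resid_sd t" using e by (simp add: resid_sd_def)
  have pos: "0 < resid_sd t" using resid_sd_ge_1[of t] by simp
  have ee: "e \<bullet> e = 1" using e by (simp add: norm_eq_1)
  have "mean_rho \<rho> (mixture \<epsilon> H_std (H_point t e n)) 0 (t *\<^sub>R e) (s * resid_sd t) = (1 - \<epsilon>) * g s"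
    using mean_rho_centred[of "H_point t e n" "t *\<^sub>R e" s]
    by (simp add: H_point_def prob_dist_return mean_rho_return sd ee)
  then show "CM_feasible \<rho> b (mixture \<epsilon> H_std (H_point t e n)) 0 (t *\<^sub>R e) (s * resid_sd t)"
    "CM_objective \<rho> c (mixture \<epsilon> H_std (H_point t e n)) 0 (t *\<^sub>R e) (s * resid_sd t)
      = A s + ln (resid_sd t)"
    using s' pos by (simp_all add: CM_feasible_def CM_objective_def A_ce_def ln_mult)
qed

text \<open>A compactness argument: if slopes stay below \<open>t\<close> while the point mass
  escapes, the standardized scales accumulate at some \<open>s\<close> for which the contamination
  counts in full, in the constraint and in the objective.\<close>

lemma lower_bound:
  fixes e :: "real ^ 'p::finite"
  assumes e: "norm e = 1" and "t' < t" and ne: "s0 \<in> S\<gamma>"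
    and sol: "\<And>n. CM_solution \<rho> b c (mixture \<epsilon> H_std (H_point t e n)) (\<alpha> n, \<theta> n, \<sigma> n)"
    and le: "\<And>n. norm (\<theta> n) \<le> t'"
  shows "\<exists>s\<in>S\<sigma>. \<forall>s'\<in>S\<gamma>. A s + c * \<epsilon> \<le> A s' + ln (resid_sd t)"
proof -
  let ?H = "\<lambda>n. mixture \<epsilon> H_std (H_point t e n)"
  have PH: "prob_dist (H_point t e n)" for n by (simp add: H_point_def prob_dist_return)
  have feas: "CM_feasible \<rho> b (?H n) (\<alpha> n) (\<theta> n) (\<sigma> n)" for n
    using sol[of n] by (simp add: CM_solution_def)
  have \<sigma>: "0 < \<sigma> n" and mb: "mean_rho \<rho> (?H n) (\<alpha> n) (\<theta> n) (\<sigma> n) \<le> b" for n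
    using feas[of n] by (simp_all add: CM_feasible_def)
  have obj: "CM_objective \<rho> c (?H n) (\<alpha> n) (\<theta> n) (\<sigma> n) \<le> A s + ln (resid_sd t)" if "s \<in> S\<gamma>" for n s
    using sol[of n] point_feasible[OF e that]
    unfolding CM_solution_def by (metis (no_types, lifting) case_prod_conv)
  define p where "p n = mean_rho \<rho> (H_point t e n) (\<alpha> n) (\<theta> n) (\<sigma> n)" for n
  have p0: "0 \<le> p n" for n using mean_rho_bounds(1)[OF PH] by (simp add: p_def)
  define s where "s n = \<sigma> n / resid_sd (\<theta> n)" for n
  have sd1: "1 \<le> resid_sd (\<theta> n)" for n by (rule resid_sd_ge_1)
  have s\<gamma>: "s n \<in> S\<gamma>" for n using feasible_scaled[OF PH feas] by (simp add: s_def)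
  have s_g: "(1 - \<epsilon>) * g (s n) + \<epsilon> * p n \<le> b" for n
    using mean_rho_ge[OF PH[of n] \<sigma>[of n], where \<theta>="\<theta> n" and \<alpha>="\<alpha> n"] mb[of n]
    unfolding s_def p_def by (rule order_trans)
  have s_A: "A (s n) + c * \<epsilon> * p n \<le> A s' + ln (resid_sd t)" if "s' \<in> S\<gamma>" for n s'
  proof -
    have "0 \<le> ln (resid_sd (\<theta> n))" using sd1 by simp
    then show ?thesis
      using objective_ge[OF PH[of n] \<sigma>[of n], where \<theta>="\<theta> n" and \<alpha>="\<alpha> n"] obj[OF that, of n]
      by (simp add: s_def p_def)
  qed
  \<comment> \<open>The mean of \<open>\<rho>\<close> is nonnegative, so \<open>ln \<sigma>\<close>
    is at most the objective, which is at most the cost of the competitor built from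
    \<open>s0\<close>.\<close>
  define S where "S = exp (A s0 + ln (resid_sd t))"
  have \<sigma>S: "\<sigma> n \<le> S" for n
  proof -
    have "0 \<le> mean_rho \<rho> (?H n) (\<alpha> n) (\<theta> n) (\<sigma> n)"
      using eps by (intro mean_rho_bounds prob_dist_mixture prob_dist_H_std PH) auto
    then have "ln (\<sigma> n) \<le> A s0 + ln (resid_sd t)"
      using obj[OF ne, of n] c mult_nonneg_nonneg[of c "mean_rho \<rho> (?H n) (\<alpha> n) (\<theta> n) (\<sigma> n)"]
      unfolding CM_objective_def by linarith
    then show ?thesis
      using \<sigma>[of n] by (simp add: S_def ln_le_cancel_iff[symmetric] del: ln_le_cancel_iff)
  qed
  have "0 < S" by (simp add: S_def)
  have "b / (1 - \<epsilon>) < 1" using eps by (simp add: field_simps)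
  \<comment> \<open>An intercept beyond \<open>M\<close> would violate the constraint through the
    normal part alone.\<close>
  from integral_rho_far[OF this \<open>0 < S\<close>, of "resid_sd t'"]
  obtain M where M: "\<And>\<alpha> r \<sigma>. 0 < \<sigma> \<Longrightarrow> \<sigma> \<le> S \<Longrightarrow> \<bar>r\<bar> \<le> resid_sd t' \<Longrightarrow> M \<le> \<bar>\<alpha>\<bar> \<Longrightarrow>
      b / (1 - \<epsilon>) < (\<integral>z. \<rho> ((r * z - \<alpha>) / \<sigma>) \<partial>N)" by blast
  have \<alpha>M: "\<bar>\<alpha> n\<bar> \<le> M" for n
  proof (rule ccontr)
    assume "\<not> \<bar>\<alpha> n\<bar> \<le> M"
    moreover have "\<bar>resid_sd (\<theta> n)\<bar> \<le> resid_sd t'"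
      using le[of n] by (auto simp: resid_sd_def intro!: power_mono)
    ultimately have "b / (1 - \<epsilon>) < (\<integral>z. \<rho> ((resid_sd (\<theta> n) * z - \<alpha> n) / \<sigma> n) \<partial>N)"
      using \<sigma> \<sigma>S by (intro M) auto
    then have "b < (1 - \<epsilon>) * (\<integral>z. \<rho> ((resid_sd (\<theta> n) * z - \<alpha> n) / \<sigma> n) \<partial>N)"
      using eps by (simp add: field_simps)
    also have "\<dots> \<le> mean_rho \<rho> (?H n) (\<alpha> n) (\<theta> n) (\<sigma> n)"
      using eps p0[of n] by (simp add: mean_rho_mixture[OF PH] p_def)
    finally show False using mb[of n] by simp
  qed
  \<comment> \<open>By Cauchy-Schwarz the residual at the contaminating point is at least
    \<open>n * (t - t') - M\<close>, and the scale is at most \<open>S\<close>. This gives an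
    explicit lower bound for \<open>p n\<close> that tends to 1.\<close>
  define \<pi> where "\<pi> n = \<rho> (max 0 ((real n * (t - t') - M) / S))" for n
  have \<pi>p: "\<pi> n \<le> p n" for n
  proof -
    have "e \<bullet> \<theta> n \<le> t'" using norm_cauchy_schwarz[of e "\<theta> n"] e le[of n] by simp
    then have "real n * (t - t') \<le> real n * (t - e \<bullet> \<theta> n)" by (intro mult_left_mono) auto
    then have res: "real n * (t - t') - M \<le> t * real n - \<alpha> n - (real n *\<^sub>R e) \<bullet> \<theta> n"
      using \<alpha>M[of n] by (simp add: algebra_simps)
    let ?r = "t * real n - \<alpha> n - (real n *\<^sub>R e) \<bullet> \<theta> n"
    have "(real n * (t - t') - M) / S \<le> \<bar>?r\<bar> / S" using res \<open>0 < S\<close> by (intro divide_right_mono) auto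
    also have "\<dots> \<le> \<bar>?r\<bar> / \<sigma> n" using \<sigma>[of n] \<sigma>S[of n] \<open>0 < S\<close> by (intro divide_left_mono) auto
    finally have "\<pi> n \<le> \<rho> (?r / \<sigma> n)"
      unfolding \<pi>_def by (intro rho_mono) (use \<sigma>[of n] in \<open>auto simp: abs_divide\<close>)
    then show ?thesis by (simp add: p_def H_point_def mean_rho_return)
  qed
  have \<pi>: "\<pi> \<longlonglongrightarrow> 1"
    unfolding \<pi>_def
  proof (rule rho_at_top)
    have "- M / S + (t - t') / S * real n = (real n * (t - t') - M) / S" for n
      using \<open>0 < S\<close> by (simp add: field_simps)
    moreover have "filterlim (\<lambda>n. - M / S + (t - t') / S * real n) at_top sequentially"
      using assms(2) \<open>0 < S\<close> by (intro filterlim_tendsto_add_at_top[OF tendsto_const]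
          filterlim_tendsto_pos_mult_at_top[OF tendsto_const] filterlim_real_sequentially) auto
    ultimately have "filterlim (\<lambda>n. (real n * (t - t') - M) / S) at_top sequentially" by (simp only:)
    then show "filterlim (\<lambda>n. max 0 ((real n * (t - t') - M) / S)) at_top sequentially"
      by (rule filterlim_at_top_mono) simp
  qed
  obtain s1 where s1: "0 < s1" "\<And>s. s \<in> S\<gamma> \<Longrightarrow> s1 \<le> s" by (rule S\<gamma>_lower_bound) blast
  have "s n \<in> {s1..S}" for n
  proof -
    have "s n \<le> \<sigma> n" using sd1[of n] \<sigma>[of n] by (simp add: s_def divide_le_eq)
    with s1(2)[OF s\<gamma>[of n]] \<sigma>S[of n] show ?thesis by simp
  qed
  \<comment> \<open>The limit point is positive because \<open>s1 > 0\<close>, so \<open>g\<close>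
    and \<open>A\<close> are continuous there and both inequalities pass to the limit.\<close>
  then obtain l r where l: "l \<in> {s1..S}" and r: "strict_mono r" and lim: "(s \<circ> r) \<longlonglongrightarrow> l"
    using compact_imp_seq_compact[OF compact_Icc[of s1 S]] unfolding seq_compact_def by blast
  have "0 < l" using l s1 by simp
  have \<pi>r: "(\<lambda>n. \<pi> (r n)) \<longlonglongrightarrow> 1" using LIMSEQ_subseq_LIMSEQ[OF \<pi> r] by (simp add: comp_def)
  have gl: "(\<lambda>n. g (s (r n))) \<longlonglongrightarrow> g l"
    using isCont_tendsto_compose[OF g_cont[OF \<open>0 < l\<close>] lim] by (simp add: comp_def)
  have Al: "(\<lambda>n. A (s (r n))) \<longlonglongrightarrow> A l"
    using isCont_tendsto_compose[OF A_cont[OF \<open>0 < l\<close>] lim] by (simp add: comp_def)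
  have "(1 - \<epsilon>) * g l + \<epsilon> * 1 \<le> b"
  proof (rule LIMSEQ_le_const2)
    show "(\<lambda>n. (1 - \<epsilon>) * g (s (r n)) + \<epsilon> * \<pi> (r n)) \<longlonglongrightarrow> (1 - \<epsilon>) * g l + \<epsilon> * 1"
      by (intro tendsto_intros gl \<pi>r)
    have "(1 - \<epsilon>) * g (s (r n)) + \<epsilon> * \<pi> (r n) \<le> b" for n
      using s_g[of "r n"] mult_left_mono[OF \<pi>p[of "r n"], of \<epsilon>] eps by linarith
    then show "\<exists>N. \<forall>n\<ge>N. (1 - \<epsilon>) * g (s (r n)) + \<epsilon> * \<pi> (r n) \<le> b" by blast
  qed
  then have "l \<in> S\<sigma>" using \<open>0 < l\<close> by (simp add: S\<sigma>_def)
  moreover have "A l + c * \<epsilon> * 1 \<le> A s' + ln (resid_sd t)" if "s' \<in> S\<gamma>" for s'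
  proof (rule LIMSEQ_le_const2)
    show "(\<lambda>n. A (s (r n)) + c * \<epsilon> * \<pi> (r n)) \<longlonglongrightarrow> A l + c * \<epsilon> * 1"
      by (intro tendsto_intros Al \<pi>r)
    have "A (s (r n)) + c * \<epsilon> * \<pi> (r n) \<le> A s' + ln (resid_sd t)" for n
      using s_A[OF that, of "r n"] mult_left_mono[OF \<pi>p[of "r n"], of "c * \<epsilon>"] eps c
        mult_pos_pos[of c \<epsilon>]
      by linarith
    then show "\<exists>N. \<forall>n\<ge>N. A (s (r n)) + c * \<epsilon> * \<pi> (r n) \<le> A s' + ln (resid_sd t)" by blast
  qed
  ultimately show ?thesis by auto
qed

text \<open>If the bias stayed below \<open>t'\<close>, the estimates at all the point
  contaminations would form a sequence of solutions as in \<open>lower_bound\<close>, contradicting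
  \<open>nex\<close>. Solutions exist there because the fit along \<open>t *\<^sub>R e\<close> is
  feasible.\<close>

lemma bias_ge:
  fixes F :: "'p::finite CM_functional" and e :: "real ^ 'p"
  assumes F: "CM_estimate \<rho> b c F"
    and ex: "\<forall>H\<in>(contamination_nbhd \<epsilon> :: (real \<times> (real ^ 'p)) measure set).
      (\<exists>\<alpha> \<theta> \<sigma>. CM_feasible \<rho> b H \<alpha> \<theta> \<sigma>) \<longrightarrow> (\<exists>s. CM_solution \<rho> b c H s)"
    and e: "norm e = 1" and t: "t' < t" and ne: "s0 \<in> S\<gamma>"
    and nex: "\<not> (\<exists>s\<in>S\<sigma>. \<forall>s'\<in>S\<gamma>. A s + c * \<epsilon> \<le> A s' + ln (resid_sd t))"
  shows "ereal t' \<le> max_bias (CM_slopes F) \<epsilon>"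
proof (rule ccontr)
  assume less: "\<not> ereal t' \<le> max_bias (CM_slopes F) \<epsilon>"
  have "\<exists>\<alpha> \<theta> \<sigma>. CM_solution \<rho> b c (mixture \<epsilon> H_std (H_point t e n)) (\<alpha>, \<theta>, \<sigma>) \<and> norm \<theta> \<le> t'" for n
  proof -
    let ?H = "mixture \<epsilon> H_std (H_point t e n)"
    have P: "prob_dist (H_point t e n)" by (simp add: H_point_def prob_dist_return)
    have nbhd: "?H \<in> contamination_nbhd \<epsilon>" using P by (auto simp: contamination_nbhd_def)
    have PH: "prob_dist ?H" using eps by (intro prob_dist_mixture prob_dist_H_std P) auto
    have "\<exists>s. CM_solution \<rho> b c ?H s"
      using ex nbhd point_feasible(1)[OF e ne, where n=n and t=t] by blast
    then obtain \<alpha> \<theta> \<sigma> where Fs: "F ?H = Some (\<alpha>, \<theta>, \<sigma>)" and sol: "CM_solution \<rho> b c ?H (\<alpha>, \<theta>, \<sigma>)"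
      using F PH unfolding CM_estimate_def by (cases "F ?H") fastforce+
    have "ereal (norm \<theta>) \<le> max_bias (CM_slopes F) \<epsilon>"
      unfolding max_bias_def
      by (rule SUP_upper2[OF nbhd]) (simp add: asymptotic_bias_def CM_slopes_def Fs)
    also have "\<dots> \<le> ereal t'" using less by simp
    finally show ?thesis using sol by auto
  qed
  then obtain \<alpha> \<theta> \<sigma> where
    "\<And>n. CM_solution \<rho> b c (mixture \<epsilon> H_std (H_point t e n)) (\<alpha> n, \<theta> n, \<sigma> n)"
    "\<And>n. norm (\<theta> n) \<le> t'" by metis
  from lower_bound[OF e t ne this] nex show False by blast
qed

section \<open>Evaluation of the maximum bias\<close>

lemma bias_infinite_if_infeasible:
  fixes F :: "'p::finite CM_functional"
  assumes F: "CM_estimate \<rho> b c F" and "S\<gamma> = {}"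
  shows "max_bias (CM_slopes F) \<epsilon> = \<infinity>"
proof -
  let ?H = "mixture \<epsilon> H_std (return borel 0) :: (real \<times> (real ^ 'p)) measure"
  have nbhd: "?H \<in> contamination_nbhd \<epsilon>" by (auto simp: contamination_nbhd_def prob_dist_return)
  have PH: "prob_dist ?H"
    using eps by (intro prob_dist_mixture prob_dist_H_std prob_dist_return) auto
  have "\<not> CM_feasible \<rho> b ?H \<alpha> \<theta> \<sigma>" for \<alpha> \<theta> \<sigma>
    using feasible_scaled[OF prob_dist_return] assms(2) by blast
  then have "\<not> CM_solution \<rho> b c ?H s" for s by (auto simp: CM_solution_def split: prod.splits)
  then have "F ?H = None"
    using F PH unfolding CM_estimate_def by (cases "F ?H") fastforce+
  then have "asymptotic_bias (CM_slopes F) ?H = \<infinity>" by (simp add: asymptotic_bias_def CM_slopes_def)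
  then have "\<infinity> \<le> max_bias (CM_slopes F) \<epsilon>"
    unfolding max_bias_def using SUP_upper[OF nbhd, of "asymptotic_bias (CM_slopes F)"] by simp
  then show ?thesis by simp
qed

lemma max_bias_eq:
  fixes F :: "'p::finite CM_functional"
  assumes F: "CM_estimate \<rho> b c F"
    and ex: "\<forall>H\<in>(contamination_nbhd \<epsilon> :: (real \<times> (real ^ 'p)) measure set).
      (\<exists>\<alpha> \<theta> \<sigma>. CM_feasible \<rho> b H \<alpha> \<theta> \<sigma>) \<longrightarrow> (\<exists>s. CM_solution \<rho> b c H s)"
  shows "max_bias (CM_slopes F) \<epsilon> =
    sqrt_ereal (exp_ereal (ereal (2 * c * \<epsilon>) + 2 * D_c \<rho> b c \<epsilon>) - 1)"
proof -
  obtain e :: "real ^ 'p" where e: "norm e = 1" using vector_choose_size[of 1] by auto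
  note bias_ge = bias_ge[OF F ex e]
  define I where "I = Inf (A ` S\<gamma>)"
  \<comment> \<open>The cases are: no fit is feasible anywhere in the neighbourhood; the
    standardized scale can absorb the constraint only if contamination does not count in full; it
    can do so even under the worst contamination. The first two give infinite bias.\<close>
  consider "S\<gamma> = {}" | "S\<gamma> \<noteq> {}" "S\<sigma> = {}" | "S\<sigma> \<noteq> {}" using S_subset by blast
  then show ?thesis
  proof cases
    case 1
    then have "S\<sigma> = {}" using S_subset by blast
    \<comment> \<open>Here the convention \<open>\<infinity> - \<infinity> = \<infinity>\<close> is
      what makes the formula agree with the infinite bias.\<close>
    then have "D_c \<rho> b c \<epsilon> = \<infinity>" using 1 by (simp add: D_c_eq top_ereal_def)
    then show ?thesis
      using bias_infinite_if_infeasible[OF F 1] by (simp add: exp_sqrt_ereal_infinity)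
  next
    case 2
    then have "(INF s\<in>S\<gamma>. ereal (A s)) = ereal I"
      unfolding I_def using ereal_Inf'[OF A_bdd_below] by (simp add: image_image)
    then have D: "D_c \<rho> b c \<epsilon> = \<infinity>" using 2 by (simp add: D_c_eq top_ereal_def)
    obtain s0 where "s0 \<in> S\<gamma>" using 2 by blast
    \<comment> \<open>With \<open>S\<sigma>\<close> empty the premise \<open>nex\<close> holds
      vacuously, so every real number is a lower bound of the bias.\<close>
    then have "ereal t \<le> max_bias (CM_slopes F) \<epsilon>" for t
      using 2 by (intro bias_ge[of t "t + 1"]) auto
    then have "max_bias (CM_slopes F) \<epsilon> = \<infinity>" by (rule ereal_top)
    then show ?thesis by (simp add: D exp_sqrt_ereal_infinity)
  next
    case 3
    then have ne: "S\<gamma> \<noteq> {}" using S_subset by blast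
    have bdd: "bdd_below (A ` S\<sigma>)" using A_bdd_below S_subset by (meson bdd_below_mono image_mono)
    define J where "J = Inf (A ` S\<sigma>)"
    have "(INF s\<in>S\<gamma>. ereal (A s)) = ereal I" "(INF s\<in>S\<sigma>. ereal (A s)) = ereal J"
      unfolding I_def J_def using ereal_Inf'[OF A_bdd_below] ereal_Inf'[OF bdd] ne 3
      by (simp_all add: image_image)
    then have D: "D_c \<rho> b c \<epsilon> = ereal (J - I)" by (simp add: D_c_eq)
    have I_le: "I \<le> A s" if "s \<in> S\<gamma>" for s
      unfolding I_def using that A_bdd_below by (intro cInf_lower) auto
    have J_le: "J \<le> A s" if "s \<in> S\<sigma>" for s
      unfolding J_def using that bdd by (intro cInf_lower) auto
    have I_J: "I \<le> J"
      unfolding I_def J_def using 3 S_subset A_bdd_below by (intro cInf_superset_mono) auto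
    \<comment> \<open>The largest \<open>ln (resid_sd \<theta>)\<close> that the comparison of costs
      permits; \<open>B\<close> is the slope length at which it is reached. It is positive since an
      infimum over the larger set \<open>S\<gamma>\<close> is no larger.\<close>
    define d where "d = c * \<epsilon> + (J - I)"
    have d: "0 < d" using I_J c eps by (simp add: d_def add_pos_nonneg)
    define B where "B = sqrt (exp (2 * d) - 1)"
    have B: "0 < B" using d by (simp add: B_def)
    have expd: "exp d = resid_sd B"
      using d by (simp add: B_def resid_sd_def exp_double)
    have rhs: "sqrt_ereal (exp_ereal (ereal (2 * c * \<epsilon>) + 2 * D_c \<rho> b c \<epsilon>) - 1) = ereal B"
    proof -
      have "2 * ereal (J - I) = ereal (2 * (J - I))" by (simp add: numeral_eq_ereal)
      then have "ereal (2 * c * \<epsilon>) + 2 * D_c \<rho> b c \<epsilon> = ereal (2 * d)"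
        by (simp add: D d_def algebra_simps)
      then show ?thesis by (simp add: B_def one_ereal_def)
    qed
    have "max_bias (CM_slopes F) \<epsilon> \<le> ereal B"
      unfolding max_bias_def
    proof (rule SUP_least)
      fix H :: "(real \<times> (real ^ 'p)) measure" assume H: "H \<in> contamination_nbhd \<epsilon>"
      then obtain H' where H': "prob_dist H'" "H = mixture \<epsilon> H_std H'"
        by (auto simp: contamination_nbhd_def)
      have PH: "prob_dist H"
        unfolding H' using eps by (intro prob_dist_mixture prob_dist_H_std H') auto
      obtain s where "s \<in> S\<sigma>" using 3 by blast
      \<comment> \<open>The zero-slope fit is feasible at every member of the neighbourhood, so the
        estimate is defined and its bias finite.\<close>
      then have "\<exists>s. CM_solution \<rho> b c H s"
        using ex H contaminated_feasible(1)[OF H'(1)] H'(2) by blast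
      then obtain \<alpha> \<theta> \<sigma> where Fs: "F H = Some (\<alpha>, \<theta>, \<sigma>)" and sol: "CM_solution \<rho> b c H (\<alpha>, \<theta>, \<sigma>)"
        using F PH unfolding CM_estimate_def by (cases "F H") fastforce+
      have "\<sigma> / resid_sd \<theta> \<in> S\<gamma>"
        using sol feasible_scaled[OF H'(1)] H'(2) by (auto simp: CM_solution_def)
      then have "I + ln (resid_sd \<theta>) - c * \<epsilon> \<le> A s" if "s \<in> S\<sigma>" for s
        using upper_bound[OF H'(1) sol[unfolded H'(2)] that] I_le by fastforce
      then have "I + ln (resid_sd \<theta>) - c * \<epsilon> \<le> J"
        unfolding J_def using 3 by (intro cInf_greatest) auto
      then have "ln (resid_sd \<theta>) \<le> d" by (simp add: d_def)
      then have "exp (ln (resid_sd \<theta>)) \<le> exp d" by simp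
      then have "norm \<theta> \<le> B"
        using resid_sd_ge_1[of \<theta>] B by (simp add: expd resid_sd_le_iff)
      then show "asymptotic_bias (CM_slopes F) H \<le> ereal B"
        by (simp add: asymptotic_bias_def CM_slopes_def Fs)
    qed
    moreover have "ereal B \<le> max_bias (CM_slopes F) \<epsilon>"
    proof (rule dense_le)
      fix x assume "x < ereal B"
      then obtain t' where t': "x < ereal t'" "t' < B" using ereal_dense2 by fastforce
      \<comment> \<open>The gap above \<open>t'\<close> drives the residual of the point mass to
        infinity, \<open>t < B\<close> refutes the cost inequality, and positivity lets
        \<open>t\<close> be compared with \<open>B\<close> through \<open>resid_sd\<close>.\<close>
      then obtain t where t: "max 0 t' < t" "t < B" using B dense[of "max 0 t'" B] by auto
      obtain s0 where s0: "s0 \<in> S\<gamma>" using ne by blast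
      have "\<not> (\<forall>s'\<in>S\<gamma>. A s + c * \<epsilon> \<le> A s' + ln (resid_sd t))" if "s \<in> S\<sigma>" for s
      proof
        assume "\<forall>s'\<in>S\<gamma>. A s + c * \<epsilon> \<le> A s' + ln (resid_sd t)"
        then have "A s + c * \<epsilon> - ln (resid_sd t) \<le> I"
          unfolding I_def using ne by (intro cInf_greatest) (auto simp: algebra_simps)
        then have "d \<le> ln (resid_sd t)" using J_le[OF that] by (simp add: d_def)
        then have "exp d \<le> exp (ln (resid_sd t))" by simp
        then have "B \<le> t"
          using resid_sd_ge_1[of t] B t by (simp add: expd resid_sd_le_iff)
        then show False using t by simp
      qed
      then have "ereal t' \<le> max_bias (CM_slopes F) \<epsilon>"
        using t s0 by (intro bias_ge[of t' t]) auto
      then show "x \<le> max_bias (CM_slopes F) \<epsilon>" using t' by simp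
    qed
    ultimately show ?thesis using rhs by simp
  qed
qed

end

theorem theorem4p1:
  fixes \<rho> :: "real \<Rightarrow> real"
    and b c \<epsilon> :: real
    and F :: "'p::finite CM_functional"
  assumes "A3 \<rho>"
    and "0 < b" and "b < 1"
    and "0 < c"
    and "CM_estimate \<rho> b c F"
    and "0 < \<epsilon>" and "\<epsilon> < min b (1 - b)"
    and "\<forall>H\<in>(contamination_nbhd \<epsilon> :: (real \<times> (real ^ 'p)) measure set).
      (\<exists>\<alpha> \<theta> \<sigma>. CM_feasible \<rho> b H \<alpha> \<theta> \<sigma>) \<longrightarrow>
      (\<exists>s. CM_solution \<rho> b c H s)"
  shows "max_bias (CM_slopes F) \<epsilon> =
    sqrt_ereal (exp_ereal (ereal (2 * c * \<epsilon>) + 2 * D_c \<rho> b c \<epsilon>) - 1)"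
proof -
  interpret CM_setting \<rho> b c \<epsilon> by unfold_locales (use assms in auto)
  show ?thesis by (rule max_bias_eq) fact+
qed

end
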